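(* Let $k$ be a field of characteristic zero. For every integer $r\ge 3$, there exist reduced level sets of points in $\mathbf P^r$ (over $k$) whose artinian reductions are non-unimodal.
   Context: All algebras are standard graded. For an artinian graded algebra $B$, its $h$-vector is $(h_0,\dots,h_e)$ with $h_i=\dim_k B_i$, where $e$ (the socle degree) is the last index with $B_e\ne0$. The socle of $B$ is the annihilator in $B$ of its maximal homogeneous ideal; $B$ is level if its socle is concentrated in degree $e$. $B$ is non-unimodal if its $h$-vector is not unimodal, i.e. there is no $j$ with $h_0\le\dots\le h_j\ge\dots\ge h_e$. A reduced set of points in $\mathbf P^r$ is a reduced zero-dimensional closed subscheme; its homogeneous coordinate ring (the quotient of $k[x_0,\dots,x_r]$ by its saturated homogeneous ideal) is a one-dimensional Cohen-Macaulay ring. An artinian reduction is the quotient of this ring by a linear form that is a non-zero-divisor; all artinian reductions have the same $h$-vector and the same graded Betti numbers. The set of points is level if its artinian reductions are level. *)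

theory Defs
  imports "HOL-Algebra.Embedded_Algebras" "HOL-Algebra.QuotRing" "HOL-Library.Poly_Mapping"
begin

section \<open>Graded algebras\<close>

text \<open>
  A graded algebra is given by a ring \<open>B\<close> together with its family \<open>G\<close> of homogeneous components.
  All algebras below are quotients of a polynomial ring by homogeneous ideals, so \<open>G 0\<close> is the
  image of the base field; it serves as the field of scalars.
\<close>

definition homogeneous_ideal :: "('a, 'm) ring_scheme \<Rightarrow> (nat \<Rightarrow> 'a set) \<Rightarrow> 'a set \<Rightarrow> bool" where
  "homogeneous_ideal B G J \<longleftrightarrow> ideal J B \<and> (\<exists>S \<subseteq> (\<Union>d. G d). J = Idl\<^bsub>B\<^esub> S)"

definition irrelevant_ideal :: "('a, 'm) ring_scheme \<Rightarrow> (nat \<Rightarrow> 'a set) \<Rightarrow> 'a set" where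
  "irrelevant_ideal B G = Idl\<^bsub>B\<^esub> (\<Union>d\<in>{1..}. G d)"

definition quot_grading ::
    "('a, 'm) ring_scheme \<Rightarrow> (nat \<Rightarrow> 'a set) \<Rightarrow> 'a set \<Rightarrow> nat \<Rightarrow> 'a set set" where
  "quot_grading B G J d = (\<lambda>a. J +>\<^bsub>B\<^esub> a) ` G d"

definition h_function :: "('a, 'm) ring_scheme \<Rightarrow> (nat \<Rightarrow> 'a set) \<Rightarrow> nat \<Rightarrow> nat" where
  "h_function B G i = ring.dim B (G 0) (G i)"

definition is_socle_degree :: "('a, 'm) ring_scheme \<Rightarrow> (nat \<Rightarrow> 'a set) \<Rightarrow> nat \<Rightarrow> bool" where
  "is_socle_degree B G e \<longleftrightarrow> G e \<noteq> {\<zero>\<^bsub>B\<^esub>} \<and> (\<forall>i>e. G i = {\<zero>\<^bsub>B\<^esub>})"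

definition socle :: "('a, 'm) ring_scheme \<Rightarrow> (nat \<Rightarrow> 'a set) \<Rightarrow> 'a set" where
  "socle B G = {b \<in> carrier B. \<forall>m \<in> irrelevant_ideal B G. m \<otimes>\<^bsub>B\<^esub> b = \<zero>\<^bsub>B\<^esub>}"

text \<open>
  The next two predicates concern artinian algebras; they are false when no last nonzero
  component exists.
\<close>

definition level_algebra :: "('a, 'm) ring_scheme \<Rightarrow> (nat \<Rightarrow> 'a set) \<Rightarrow> bool" where
  "level_algebra B G \<longleftrightarrow> (\<exists>e. is_socle_degree B G e \<and> socle B G \<subseteq> G e)"

definition unimodal :: "nat list \<Rightarrow> bool" where
  "unimodal h \<longleftrightarrow> (\<exists>j < length h. sorted_wrt (\<le>) (take (Suc j) h) \<and> sorted_wrt (\<ge>) (drop j h))"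

definition nonunimodal_algebra :: "('a, 'm) ring_scheme \<Rightarrow> (nat \<Rightarrow> 'a set) \<Rightarrow> bool" where
  "nonunimodal_algebra B G \<longleftrightarrow>
     (\<exists>e. is_socle_degree B G e \<and> \<not> unimodal (map (h_function B G) [0..<Suc e]))"


section \<open>The polynomial ring in the variables $x_0, \dots, x_r$\<close>

text \<open>
  A monomial is its exponent vector \<^typ>\<open>nat \<Rightarrow>\<^sub>0 nat\<close>; only the variables with index at most \<open>r\<close>
  are allowed.
\<close>

type_synonym 'k mpoly = "(nat \<Rightarrow>\<^sub>0 nat) \<Rightarrow>\<^sub>0 'k"

definition mpoly_ring :: "nat \<Rightarrow> 'k::field mpoly ring" where
  "mpoly_ring r = \<lparr>carrier = {p. \<forall>m \<in> Poly_Mapping.keys p. Poly_Mapping.keys m \<subseteq> {..r}},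
     monoid.mult = (*), one = 1, zero = 0, add = (+)\<rparr>"

definition forms :: "nat \<Rightarrow> nat \<Rightarrow> 'k::field mpoly set" where
  "forms r d = {p \<in> carrier (mpoly_ring r). \<forall>m \<in> Poly_Mapping.keys p.
     (\<Sum>i\<in>Poly_Mapping.keys m. Poly_Mapping.lookup m i) = d}"

lemma cring_mpoly_ring: "cring (mpoly_ring r :: 'k::field mpoly ring)"
proof (rule cringI)
  show "abelian_group (mpoly_ring r :: 'k mpoly ring)"
  proof (rule abelian_groupI)
    fix x y :: "'k mpoly"
    assume "x \<in> carrier (mpoly_ring r)" "y \<in> carrier (mpoly_ring r)"
    then show "x \<oplus>\<^bsub>mpoly_ring r\<^esub> y \<in> carrier (mpoly_ring r)"
      using keys_add[of x y] by (auto simp: mpoly_ring_def)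
  next
    fix x :: "'k mpoly"
    assume "x \<in> carrier (mpoly_ring r)"
    then show "\<exists>y \<in> carrier (mpoly_ring r). y \<oplus>\<^bsub>mpoly_ring r\<^esub> x = \<zero>\<^bsub>mpoly_ring r\<^esub>"
      by (intro bexI[of _ "- x"]) (auto simp: mpoly_ring_def in_keys_iff)
  qed (auto simp: mpoly_ring_def algebra_simps)
  show "comm_monoid (mpoly_ring r :: 'k mpoly ring)"
  proof (rule comm_monoidI)
    fix x y :: "'k mpoly"
    assume *: "x \<in> carrier (mpoly_ring r)" "y \<in> carrier (mpoly_ring r)"
    have "Poly_Mapping.keys m \<subseteq> {..r}" if m: "m \<in> Poly_Mapping.keys (x * y)" for m
    proof -
      obtain a b where "m = a + b" "a \<in> Poly_Mapping.keys x" "b \<in> Poly_Mapping.keys y"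
        using keys_mult[of x y] m by blast
      then show ?thesis
        using * keys_add[of a b] by (fastforce simp: mpoly_ring_def)
    qed
    then show "x \<otimes>\<^bsub>mpoly_ring r\<^esub> y \<in> carrier (mpoly_ring r)"
      by (auto simp: mpoly_ring_def)
  qed (auto simp: mpoly_ring_def algebra_simps)
qed (auto simp: mpoly_ring_def algebra_simps)


section \<open>Reduced sets of points in projective space\<close>

text \<open>
  A closed subscheme of $\mathbf{P}^r$ is represented by its saturated homogeneous ideal.  The
  homogeneous components \<open>forms r n\<close> generate the powers of the irrelevant ideal.
\<close>

definition saturated :: "nat \<Rightarrow> 'k::field mpoly set \<Rightarrow> bool" where
  "saturated r I \<longleftrightarrow>
     (\<forall>f \<in> carrier (mpoly_ring r). (\<exists>n. \<forall>g \<in> forms r n. g \<otimes>\<^bsub>mpoly_ring r\<^esub> f \<in> I) \<longrightarrow> f \<in> I)"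

text \<open>
  The underlying space of the subscheme, as a subset of $\mathbf{P}^r = \mathrm{Proj}\,
  k[x_0, \dots, x_r]$.  Its irreducible closed subsets correspond to its elements, with inclusions
  reversed, so it has dimension zero iff it is nonempty and has no proper inclusions.
\<close>

definition proj_zeros :: "nat \<Rightarrow> 'k::field mpoly set \<Rightarrow> 'k mpoly set set" where
  "proj_zeros r I = {P. primeideal P (mpoly_ring r) \<and> homogeneous_ideal (mpoly_ring r) (forms r) P \<and>
     \<not> irrelevant_ideal (mpoly_ring r) (forms r) \<subseteq> P \<and> I \<subseteq> P}"

definition zero_dimensional :: "nat \<Rightarrow> 'k::field mpoly set \<Rightarrow> bool" where
  "zero_dimensional r I \<longleftrightarrow> proj_zeros r I \<noteq> {} \<and>
     (\<forall>P \<in> proj_zeros r I. \<forall>Q \<in> proj_zeros r I. P \<subseteq> Q \<longrightarrow> P = Q)"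

definition coord_ring :: "nat \<Rightarrow> 'k::field mpoly set \<Rightarrow> 'k mpoly set ring" where
  "coord_ring r I = mpoly_ring r Quot I"

definition coord_grading :: "nat \<Rightarrow> 'k::field mpoly set \<Rightarrow> nat \<Rightarrow> 'k mpoly set set" where
  "coord_grading r I = quot_grading (mpoly_ring r) (forms r) I"

definition reduced_ring :: "('a, 'm) ring_scheme \<Rightarrow> bool" where
  "reduced_ring A \<longleftrightarrow> (\<forall>a \<in> carrier A. \<forall>n::nat. a [^]\<^bsub>A\<^esub> n = \<zero>\<^bsub>A\<^esub> \<longrightarrow> a = \<zero>\<^bsub>A\<^esub>)"

text \<open>
  For saturated \<open>I\<close>, the subscheme is reduced iff its homogeneous coordinate ring is.  The points
  need not be rational over the base field.
\<close>

definition reduced_point_set :: "nat \<Rightarrow> 'k::field mpoly set \<Rightarrow> bool" where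
  "reduced_point_set r I \<longleftrightarrow> homogeneous_ideal (mpoly_ring r) (forms r) I \<and> saturated r I \<and>
     zero_dimensional r I \<and> reduced_ring (coord_ring r I)"


section \<open>Artinian reductions\<close>

definition regular_linear_forms :: "nat \<Rightarrow> 'k::field mpoly set \<Rightarrow> 'k mpoly set set" where
  "regular_linear_forms r I = {l \<in> coord_grading r I 1. \<forall>a \<in> carrier (coord_ring r I).
     l \<otimes>\<^bsub>coord_ring r I\<^esub> a = \<zero>\<^bsub>coord_ring r I\<^esub> \<longrightarrow> a = \<zero>\<^bsub>coord_ring r I\<^esub>}"

definition artinian_reduction ::
    "nat \<Rightarrow> 'k::field mpoly set \<Rightarrow> 'k mpoly set \<Rightarrow> 'k mpoly set set ring" where
  "artinian_reduction r I l = coord_ring r I Quot (PIdl\<^bsub>coord_ring r I\<^esub> l)"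

definition artinian_reduction_grading ::
    "nat \<Rightarrow> 'k::field mpoly set \<Rightarrow> 'k mpoly set \<Rightarrow> nat \<Rightarrow> 'k mpoly set set set" where
  "artinian_reduction_grading r I l =
     quot_grading (coord_ring r I) (coord_grading r I) (PIdl\<^bsub>coord_ring r I\<^esub> l)"

definition level_point_set :: "nat \<Rightarrow> 'k::field mpoly set \<Rightarrow> bool" where
  "level_point_set r I \<longleftrightarrow> (\<forall>l \<in> regular_linear_forms r I.
     level_algebra (artinian_reduction r I l) (artinian_reduction_grading r I l))"

end

theory Submission
  imports Defs "HOL-Computational_Algebra.Polynomial"
begin

text \<open>
  Let \<open>Z\<close> be a finite lower set in $\mathbf{N}^r$, all of whose maximal elements have the same size
  \<open>e\<close>, and view it as the set of points $(1 : a_1 : \dots : a_r)$.  The Newton polynomials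
  $N_b = \prod_j \prod_{t < b_j} (x_j - t x_0)$ with $b \in Z$ form a basis of the functions on \<open>Z\<close>,
  those with $|b| \le d$ span the functions given by forms of degree \<open>d\<close>, and
  $x_j N_b = b_j N_b + N_{b + e_j}$ on $x_0 = 1$.  So multiplication by a linear form without zeros
  on \<open>Z\<close> is triangular with nonzero diagonal, and the $N_b$ with $|b| = i$ are a basis of degree
  \<open>i\<close> of the artinian reduction by that form.  Moreover a function of degree \<open>d < e\<close> that stays of
  degree \<open>d\<close> after multiplication by each $x_j$ has no Newton coefficient of size \<open>d\<close>, because every
  $b \in Z$ with $|b| = d$ has some $b + e_j \in Z$; hence the reduction is level.

  The lower set in the example consists of the points in the planes $a_1 = 0, 1, 2$ with $|a|
  \le 12$ together with a $4 \times 4 \times 4$ grid, a complete intersection of quartics,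
  shifted by 3 in the first coordinate. In degrees 9 to 12 the \<open>h\<close>-vector is $3i$
  plus the last entries 10, 6, 3, 1 of the \<open>h\<close>-vector of the grid, that is 37, 36,
  36, 37.
\<close>

section \<open>Evaluation on lines through the origin\<close>

abbreviation "keys \<equiv> Poly_Mapping.keys"
abbreviation "lookup \<equiv> Poly_Mapping.lookup"
abbreviation "single \<equiv> Poly_Mapping.single"

definition weight :: "(nat \<Rightarrow>\<^sub>0 nat) \<Rightarrow> nat" where
  "weight m = (\<Sum>i\<in>keys m. lookup m i)"

definition mono_at :: "(nat \<Rightarrow> 'k::field) \<Rightarrow> (nat \<Rightarrow>\<^sub>0 nat) \<Rightarrow> 'k" where
  "mono_at p m = (\<Prod>i\<in>keys m. p i ^ lookup m i)"

lemma weight_zero [simp]: "weight 0 = 0"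
  by (simp add: weight_def)

lemma weight_add: "weight (m + n) = weight m + weight n"
  unfolding weight_def by (rule setsum_keys_plus_distrib) auto

lemma weight_single [simp]: "weight (single i n) = n"
  by (simp add: weight_def)

lemma mono_at_superset:
  assumes "finite S" "keys m \<subseteq> S"
  shows "mono_at p m = (\<Prod>i\<in>S. p i ^ lookup m i)"
  unfolding mono_at_def using assms
  by (intro prod.mono_neutral_left) (auto simp: in_keys_iff)

lemma mono_at_zero [simp]: "mono_at p 0 = 1"
  by (simp add: mono_at_def)

lemma mono_at_add: "mono_at p (m + n) = mono_at p m * mono_at p n"
proof -
  let ?S = "keys m \<union> keys n"
  have "mono_at p (m + n) = (\<Prod>i\<in>?S. p i ^ lookup (m + n) i)"
    using keys_add[of m n] by (intro mono_at_superset) auto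
  also have "\<dots> = (\<Prod>i\<in>?S. p i ^ lookup m i) * (\<Prod>i\<in>?S. p i ^ lookup n i)"
    by (simp add: lookup_add power_add prod.distrib)
  also have "\<dots> = mono_at p m * mono_at p n"
    by (subst (1 2) mono_at_superset[of ?S]) auto
  finally show ?thesis .
qed

lemma mono_at_single [simp]: "mono_at p (single i (Suc 0)) = p i"
  by (simp add: mono_at_def)

lemma sum_single_keys: "f = (\<Sum>m\<in>keys f. single m (lookup f m))"
  by (rule poly_mapping_eqI) (auto simp: lookup_sum lookup_single when_def in_keys_iff)

text \<open>This is f(t p) as a polynomial in the line parameter t. Its coefficient of t^d is the
  value at p of the degree d part of f, so the grading becomes visible in a univariate polynomial
  domain.\<close>

definition on_line :: "(nat \<Rightarrow> 'k::field) \<Rightarrow> 'k mpoly \<Rightarrow> 'k poly" where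
  "on_line p f = (\<Sum>m\<in>keys f. monom (lookup f m * mono_at p m) (weight m))"

lemma on_line_superset:
  assumes "finite S" "keys f \<subseteq> S"
  shows "on_line p f = (\<Sum>m\<in>S. monom (lookup f m * mono_at p m) (weight m))"
  unfolding on_line_def using assms
  by (intro sum.mono_neutral_left) (auto simp: in_keys_iff)

lemma on_line_zero [simp]: "on_line p 0 = 0"
  by (simp add: on_line_def)

lemma on_line_add [simp]: "on_line p (f + g) = on_line p f + on_line p g"
proof -
  let ?S = "keys f \<union> keys g"
  have "on_line p (f + g) = (\<Sum>m\<in>?S. monom (lookup (f + g) m * mono_at p m) (weight m))"
    using keys_add[of f g] by (intro on_line_superset) auto
  also have "\<dots> = (\<Sum>m\<in>?S. monom (lookup f m * mono_at p m) (weight m))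
      + (\<Sum>m\<in>?S. monom (lookup g m * mono_at p m) (weight m))"
    by (simp add: lookup_add distrib_right add_monom[symmetric] sum.distrib)
  also have "\<dots> = on_line p f + on_line p g"
    by (subst (1 2) on_line_superset[of ?S]) auto
  finally show ?thesis .
qed

lemma on_line_sum [simp]: "on_line p (sum f S) = (\<Sum>s\<in>S. on_line p (f s))"
  by (induction S rule: infinite_finite_induct) auto

lemma on_line_single [simp]: "on_line p (single m c) = monom (c * mono_at p m) (weight m)"
  by (simp add: on_line_def)

lemma on_line_uminus [simp]: "on_line p (- f) = - on_line p f"
  using on_line_add[of p f "- f"] by (simp add: eq_neg_iff_add_eq_0 add.commute)

lemma on_line_diff [simp]: "on_line p (f - g) = on_line p f - on_line p g"
  using on_line_add[of p f "- g"] by simp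

lemma on_line_mult [simp]: "on_line p (f * g) = on_line p f * on_line p g"
proof -
  have "f * g = (\<Sum>m\<in>keys f. \<Sum>n\<in>keys g. single (m + n) (lookup f m * lookup g n))"
    by (subst sum_single_keys[of f], subst sum_single_keys[of g])
      (simp add: sum_product mult_single)
  then show ?thesis
    by (simp add: on_line_def[of p f] on_line_def[of p g] sum_product mult_monom weight_add
        mono_at_add algebra_simps)
qed

lemma on_line_one [simp]: "on_line p 1 = 1"
  unfolding single_one[symmetric] on_line_single by simp

lemma on_line_power [simp]: "on_line p (f ^ n) = on_line p f ^ n"
  by (induction n) auto

lemma on_line_prod [simp]: "on_line p (prod f S) = (\<Prod>s\<in>S. on_line p (f s))"
  by (induction S rule: infinite_finite_induct) auto

text \<open>Setting t = 1 gives the value at p and inherits every homomorphism rule from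
  \<open>on_line\<close>.\<close>

definition val :: "(nat \<Rightarrow> 'k::field) \<Rightarrow> 'k mpoly \<Rightarrow> 'k" where
  "val p f = poly (on_line p f) 1"

lemma val_simps [simp]:
  "val p 0 = 0" "val p 1 = 1" "val p (f + g) = val p f + val p g" "val p (- f) = - val p f"
  "val p (f - g) = val p f - val p g" "val p (f * g) = val p f * val p g"
  "val p (f ^ n) = val p f ^ n" "val p (sum F S) = (\<Sum>s\<in>S. val p (F s))"
  "val p (prod F S) = (\<Prod>s\<in>S. val p (F s))" "val p (single m c) = c * mono_at p m"
  by (simp_all add: val_def poly_sum poly_prod poly_monom)

section \<open>Homogeneous forms and homogeneous components\<close>

abbreviation var :: "nat \<Rightarrow> 'k::field mpoly" where
  "var i \<equiv> single (single i 1) 1"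

lemma mpoly_ring_simps [simp]:
  "f \<otimes>\<^bsub>mpoly_ring r\<^esub> g = f * g" "\<one>\<^bsub>mpoly_ring r\<^esub> = 1"
  "\<zero>\<^bsub>mpoly_ring r\<^esub> = 0" "f \<oplus>\<^bsub>mpoly_ring r\<^esub> g = f + g"
  by (simp_all add: mpoly_ring_def)

lemma forms_iff:
  "f \<in> forms r d \<longleftrightarrow> (\<forall>m\<in>keys f. keys m \<subseteq> {..r} \<and> weight m = d)"
  by (auto simp: forms_def mpoly_ring_def weight_def)

lemma forms_carrier [dest]: "f \<in> forms r d \<Longrightarrow> f \<in> carrier (mpoly_ring r)"
  by (simp add: forms_def)

lemma zero_in_forms [simp]: "0 \<in> forms r d"
  by (simp add: forms_iff)

lemma forms_add [intro]: "f \<in> forms r d \<Longrightarrow> g \<in> forms r d \<Longrightarrow> f + g \<in> forms r d"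
  using keys_add[of f g] by (auto simp: forms_iff)

lemma forms_uminus [intro]: "f \<in> forms r d \<Longrightarrow> - f \<in> forms r d"
  by (auto simp: forms_iff in_keys_iff)

lemma forms_diff [intro]: "f \<in> forms r d \<Longrightarrow> g \<in> forms r d \<Longrightarrow> f - g \<in> forms r d"
  using forms_add[of f r d "- g"] by auto

lemma forms_sum [intro]: "(\<And>s. s \<in> S \<Longrightarrow> F s \<in> forms r d) \<Longrightarrow> sum F S \<in> forms r d"
  by (induction S rule: infinite_finite_induct) auto

lemma forms_mult [intro]:
  assumes "f \<in> forms r d" "g \<in> forms r d'" shows "f * g \<in> forms r (d + d')"
  unfolding forms_iff
proof
  fix m assume "m \<in> keys (f * g)"
  then obtain a b where "m = a + b" "a \<in> keys f" "b \<in> keys g"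
    using keys_mult[of f g] by blast
  with assms show "keys m \<subseteq> {..r} \<and> weight m = d + d'"
    using keys_add[of a b] by (fastforce simp: forms_iff weight_add)
qed

lemma one_in_forms [simp]: "1 \<in> forms r 0"
  by (simp add: forms_iff)

lemma forms_power [intro]: "f \<in> forms r d \<Longrightarrow> f ^ n \<in> forms r (n * d)"
  by (induction n) auto

lemma forms_prod [intro]:
  "(\<And>s. s \<in> S \<Longrightarrow> F s \<in> forms r (D s)) \<Longrightarrow> prod F S \<in> forms r (sum D S)"
  by (induction S rule: infinite_finite_induct) auto

lemma single_in_forms [intro]: "keys m \<subseteq> {..r} \<Longrightarrow> weight m = d \<Longrightarrow> single m c \<in> forms r d"
  by (simp add: forms_iff)

lemma var_in_forms [intro]: "j \<le> r \<Longrightarrow> var j \<in> forms r (Suc 0)"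
  by (intro single_in_forms) auto

lemma on_line_form: "f \<in> forms r d \<Longrightarrow> on_line p f = monom (val p f) d"
  by (auto simp: on_line_def val_def forms_iff poly_sum poly_monom monom_sum)

text \<open>Weight 0 forces every exponent to be 0. This identifies the degree 0 part with the base
  field.\<close>

lemma zero_form_const:
  assumes "f \<in> forms r 0" obtains c where "f = single 0 c"
proof -
  have "keys f \<subseteq> {0}"
  proof
    fix m assume "m \<in> keys f"
    with assms have "weight m = 0" by (auto simp: forms_iff)
    then have "lookup m i = 0" for i by (cases "i \<in> keys m") (auto simp: weight_def in_keys_iff)
    then have "m = 0" by (intro poly_mapping_eqI) simp
    then show "m \<in> {0}" by simp
  qed
  then have "f = single 0 (lookup f 0)"
    by (intro poly_mapping_eqI) (auto simp: lookup_single when_def in_keys_iff)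
  then show thesis by (rule that)
qed

definition component :: "nat \<Rightarrow> 'k::field mpoly \<Rightarrow> 'k mpoly" where
  "component d f = (\<Sum>m\<in>{m\<in>keys f. weight m = d}. single m (lookup f m))"

lemma component_in_forms [intro]: "f \<in> carrier (mpoly_ring r) \<Longrightarrow> component d f \<in> forms r d"
  unfolding component_def by (intro forms_sum single_in_forms) (auto simp: mpoly_ring_def)

lemma sum_components: "f = (\<Sum>d\<in>weight ` keys f. component d f)"
  unfolding component_def by (subst sum_single_keys) (rule sum.image_gen, simp)

text \<open>Both sides collect the monomials of weight d. Hence \<open>on_line p f\<close> is zero
  exactly when all components of f vanish at p.\<close>

lemma val_component: "val p (component d f) = coeff (on_line p f) d"
proof -
  have "coeff (on_line p f) d
      = (\<Sum>m\<in>keys f. if weight m = d then lookup f m * mono_at p m else 0)"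
    by (simp add: on_line_def coeff_sum)
  also have "\<dots> = (\<Sum>m\<in>{m\<in>keys f. weight m = d}. lookup f m * mono_at p m)"
    by (simp add: sum.inter_filter)
  finally show ?thesis by (simp add: component_def)
qed

section \<open>Newton interpolation on lower sets\<close>

text \<open>A triangular system \<open>D b * c b + F c b = u b\<close>, whose off-diagonal part
  \<open>F c b\<close> sees only unknowns of smaller weight. It has two instances: Newton
  interpolation, and multiplication by a linear form acting on Newton coefficients.\<close>

locale triangular_operator =
  fixes S :: "'a set" and w :: "'a \<Rightarrow> nat" and D :: "'a \<Rightarrow> 'k::field"
    and F :: "('a \<Rightarrow> 'k) \<Rightarrow> 'a \<Rightarrow> 'k"
  assumes diagonal: "b \<in> S \<Longrightarrow> D b \<noteq> 0"
    and lower: "b \<in> S \<Longrightarrow> (\<And>a. a \<in> S \<Longrightarrow> w a < w b \<Longrightarrow> c a = c' a) \<Longrightarrow> F c b = F c' b"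
begin

lemma injective:
  assumes "\<And>b. b \<in> S \<Longrightarrow> D b * c b + F c b = D b * c' b + F c' b" "b \<in> S"
  shows "c b = c' b"
  using assms(2)
proof (induction "w b" arbitrary: b rule: less_induct)
  case less
  then have "F c b = F c' b" by (intro lower) auto
  with assms(1)[OF less.prems] diagonal[OF less.prems] show ?case by simp
qed

text \<open>Forward substitution: once the unknowns of weight below n are known, those of weight n
  are found by dividing by the diagonal.\<close>

lemma solution_below:
  "\<exists>c. \<forall>b\<in>S. w b < n \<longrightarrow> D b * c b + F c b = u b"
proof (induction n)
  case (Suc n)
  then obtain c where c: "\<And>b. b \<in> S \<Longrightarrow> w b < n \<Longrightarrow> D b * c b + F c b = u b" by blast
  define c' where "c' = (\<lambda>b. if w b = n then (u b - F c b) / D b else c b)"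
  have "D b * c' b + F c' b = u b" if b: "b \<in> S" "w b < Suc n" for b
  proof -
    have "F c' b = F c b" using b by (intro lower) (auto simp: c'_def)
    then show ?thesis using b c[of b] diagonal[of b] by (auto simp: c'_def)
  qed
  then show ?case by blast
qed simp

text \<open>The solution is extended by 0 outside S; when S consists of the exponents of small size,
  this is a degree bound on the solution.\<close>

lemma surjective:
  assumes "finite S"
  shows "\<exists>c. (\<forall>b. b \<notin> S \<longrightarrow> c b = 0) \<and> (\<forall>b\<in>S. D b * c b + F c b = u b)"
proof -
  obtain n where n: "\<forall>b\<in>S. w b < n"
    using finite_nat_set_iff_bounded[of "w ` S"] assms by auto
  obtain c where c: "\<forall>b\<in>S. w b < n \<longrightarrow> D b * c b + F c b = u b"
    using solution_below by blast
  define c' where "c' = (\<lambda>b. if b \<in> S then c b else 0)"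
  have "F c' b = F c b" if "b \<in> S" for b
    using that by (intro lower) (auto simp: c'_def)
  with c n show ?thesis by (intro exI[of _ c']) (auto simp: c'_def)
qed

end

section \<open>Exponent vectors and lower sets\<close>

definition up :: "nat \<Rightarrow> (nat \<Rightarrow> nat) \<Rightarrow> nat \<Rightarrow> nat" where
  "up j a = a(j := Suc (a j))"

text \<open>Truncated subtraction fixes \<open>a\<close> when \<open>a j = 0\<close>, which is why
  \<open>shift\<close> treats that case separately.\<close>

definition down :: "nat \<Rightarrow> (nat \<Rightarrow> nat) \<Rightarrow> nat \<Rightarrow> nat" where
  "down j a = a(j := a j - 1)"

lemma down_up [simp]: "down j (up j a) = a"
  by (auto simp: up_def down_def)

lemma up_down: "a j \<noteq> 0 \<Longrightarrow> up j (down j a) = a"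
  by (auto simp: up_def down_def)

lemma up_apply [simp]: "up j a j = Suc (a j)"
  by (simp add: up_def)

lemma down_le: "down j a \<le> a"
  by (auto simp: down_def le_fun_def)

definition point :: "(nat \<Rightarrow> nat) \<Rightarrow> nat \<Rightarrow> 'k::field_char_0" where
  "point a i = (if i = 0 then 1 else of_nat (a i))"

text \<open>Elements of \<open>Z\<close> play two roles: they are the affine points, and they are
  the exponents b of the Newton polynomials N_b. By \<open>supported\<close> only the coordinates 1
  to r carry information.\<close>

locale lower_set =
  fixes r :: nat and Z :: "(nat \<Rightarrow> nat) set"
  assumes finite_Z: "finite Z"
    and zero_in_Z: "(\<lambda>_. 0) \<in> Z"
    and supported: "a \<in> Z \<Longrightarrow> i \<notin> {1..r} \<Longrightarrow> a i = 0"
    and lower: "a \<in> Z \<Longrightarrow> b \<le> a \<Longrightarrow> b \<in> Z"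
begin

definition size :: "(nat \<Rightarrow> nat) \<Rightarrow> nat" where
  "size a = (\<Sum>j\<in>{1..r}. a j)"

lemma size_up [simp]: "j \<in> {1..r} \<Longrightarrow> size (up j a) = Suc (size a)"
  by (simp add: size_def up_def sum.remove[of _ j])

lemma size_down: "j \<in> {1..r} \<Longrightarrow> a j \<noteq> 0 \<Longrightarrow> size a = Suc (size (down j a))"
  using size_up[of j "down j a"] by (simp add: up_down)

lemma down_in_Z: "a \<in> Z \<Longrightarrow> down j a \<in> Z"
  using lower down_le by blast

definition newton :: "(nat \<Rightarrow> nat) \<Rightarrow> (nat \<Rightarrow> nat) \<Rightarrow> 'k::field_char_0" where
  "newton b a = (\<Prod>j\<in>{1..r}. \<Prod>t<b j. of_nat (a j) - of_nat t)"

text \<open>In characteristic zero the factor for t vanishes only at t = \<open>a j\<close>, and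
  this t occurs in the product iff \<open>a j < b j\<close>.\<close>

lemma newton_eq_0_iff:
  "(newton b a :: 'k::field_char_0) = 0 \<longleftrightarrow> (\<exists>j\<in>{1..r}. a j < b j)"
proof -
  have "(\<Prod>t<b j. of_nat (a j) - of_nat t :: 'k) = 0 \<longleftrightarrow> a j < b j" for j
    by auto
  then show ?thesis by (simp add: newton_def del: prod_zero_iff lessThan_iff) simp
qed

text \<open>Raising \<open>b j\<close> adds the single factor for t = \<open>b j\<close>. This is
  the recurrence x_j N_b = b_j N_b + N_(b+e_j) on values.\<close>

lemma newton_up:
  assumes "j \<in> {1..r}"
  shows "newton (up j b) a = (of_nat (a j) - of_nat (b j)) * (newton b a :: 'k::field_char_0)"
proof -
  have "newton (up j b) a = (\<Prod>t<Suc (b j). of_nat (a j) - of_nat t)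
      * (\<Prod>i\<in>{1..r}-{j}. \<Prod>t<b i. of_nat (a i) - of_nat t :: 'k)"
    using assms unfolding newton_def by (subst prod.remove[of _ j]) (auto simp: up_def)
  also have "\<dots> = (of_nat (a j) - of_nat (b j)) * newton b a"
    using assms unfolding newton_def by (subst (2) prod.remove[of _ j]) auto
  finally show ?thesis .
qed

lemma newton_nonzero_le:
  assumes "(newton b a :: 'k::field_char_0) \<noteq> 0" "\<And>i. i \<notin> {1..r} \<Longrightarrow> b i = 0"
  shows "b \<le> a"
proof (rule le_funI)
  fix i show "b i \<le> a i"
    using assms by (cases "i \<in> {1..r}") (auto simp: newton_eq_0_iff not_less)
qed

text \<open>A nonzero value forces \<open>b \<le> a\<close>, and some coordinate is then strictly
  smaller. So the evaluation matrix is triangular with respect to \<open>size\<close>.\<close>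

lemma newton_nonzero_size:
  assumes "(newton b a :: 'k::field_char_0) \<noteq> 0" "a \<in> Z" "b \<in> Z" "b \<noteq> a"
  shows "size b < size a"
proof -
  have le: "b \<le> a" using assms supported by (intro newton_nonzero_le) auto
  obtain i where i: "b i \<noteq> a i" using assms by auto
  with assms supported have "i \<in> {1..r}" by metis
  show ?thesis unfolding size_def
  proof (rule sum_strict_mono_ex1)
    show "\<forall>j\<in>{1..r}. b j \<le> a j" using le by (simp add: le_fun_def)
    show "\<exists>j\<in>{1..r}. b j < a j"
      using le i \<open>i \<in> {1..r}\<close> by (metis le_fun_def order.strict_iff_order)
  qed simp
qed

definition interp :: "((nat \<Rightarrow> nat) \<Rightarrow> 'k::field_char_0) \<Rightarrow> (nat \<Rightarrow> nat) \<Rightarrow> 'k" where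
  "interp c a = (\<Sum>b\<in>Z. c b * newton b a)"

text \<open>The diagonal entry \<open>newton a a\<close> is the product of the factorials of the
  coordinates of a, nonzero in characteristic zero.\<close>

lemma interp_triangular:
  "triangular_operator Z size (\<lambda>a. newton a a :: 'k::field_char_0)
     (\<lambda>c a. \<Sum>b\<in>Z-{a}. c b * newton b a)"
proof
  fix a and c c' :: "(nat \<Rightarrow> nat) \<Rightarrow> 'k"
  assume a: "a \<in> Z" and eq: "\<And>b. b \<in> Z \<Longrightarrow> size b < size a \<Longrightarrow> c b = c' b"
  show "(\<Sum>b\<in>Z-{a}. c b * newton b a) = (\<Sum>b\<in>Z-{a}. c' b * newton b a)"
  proof (rule sum.cong)
    fix b assume "b \<in> Z - {a}"
    with a eq newton_nonzero_size[of b a] show "c b * newton b a = c' b * newton b a"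
      by (cases "newton b a = (0::'k)") auto
  qed simp
qed (simp add: newton_eq_0_iff)

lemma interp_split:
  "a \<in> Z \<Longrightarrow> interp c a = newton a a * c a + (\<Sum>b\<in>Z-{a}. c b * newton b a)"
  unfolding interp_def by (subst sum.remove[of _ a]) (auto simp: finite_Z)

lemma interp_inject:
  fixes c :: "(nat \<Rightarrow> nat) \<Rightarrow> 'k::field_char_0"
  assumes "\<And>a. a \<in> Z \<Longrightarrow> interp c a = interp c' a" "b \<in> Z"
  shows "c b = c' b"
proof -
  interpret triangular_operator Z size "\<lambda>a. newton a a :: 'k"
    "\<lambda>c a. \<Sum>b\<in>Z-{a}. c b * newton b a"
    by (rule interp_triangular)
  show ?thesis
    by (rule injective[OF _ assms(2)])
      (simp only: interp_split[of _ c, symmetric] interp_split[of _ c', symmetric] assms(1))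
qed

lemma interp_surj:
  fixes u :: "(nat \<Rightarrow> nat) \<Rightarrow> 'k::field_char_0"
  shows "\<exists>c. (\<forall>b. b \<notin> Z \<longrightarrow> c b = 0) \<and> (\<forall>a\<in>Z. interp c a = u a)"
proof -
  interpret triangular_operator Z size "\<lambda>a. newton a a :: 'k"
    "\<lambda>c a. \<Sum>b\<in>Z-{a}. c b * newton b a"
    by (rule interp_triangular)
  obtain c where c: "\<forall>b. b \<notin> Z \<longrightarrow> c b = 0"
    "\<forall>a\<in>Z. newton a a * c a + (\<Sum>b\<in>Z-{a}. c b * newton b a) = u a"
    using surjective[OF finite_Z, of u] by blast
  have "\<forall>a\<in>Z. interp c a = u a" using c(2) by (simp add: interp_split[of _ c])
  with c(1) show ?thesis by blast
qed

text \<open>The effect on coefficients of replacing every N_b by N_(b+e_j).\<close>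

definition shift :: "nat \<Rightarrow> ((nat \<Rightarrow> nat) \<Rightarrow> 'k::field_char_0) \<Rightarrow> (nat \<Rightarrow> nat) \<Rightarrow> 'k" where
  "shift j c a = (if a j = 0 then 0 else c (down j a))"

lemma sum_shift:
  assumes j: "j \<in> {1..r}" and a: "a \<in> Z"
  shows "(\<Sum>b\<in>Z. c b * newton (up j b) a) = interp (shift j c :: _ \<Rightarrow> 'k::field_char_0) a"
proof -
  \<comment> \<open>Here the lower set property enters: a Newton polynomial nonzero at a point of
    \<open>Z\<close> has its exponent below that point, hence in \<open>Z\<close>. Exponents pushed
    out of \<open>Z\<close> thus contribute nothing.\<close>
  have *: "newton (up j b) a = (0::'k)" if "b \<in> Z" "up j b \<notin> Z" for b
  proof (rule ccontr)
    assume "newton (up j b) a \<noteq> (0::'k)"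
    then have "up j b \<le> a"
      using j that supported by (intro newton_nonzero_le) (auto simp: up_def)
    with a lower that show False by blast
  qed
  have "(\<Sum>b\<in>Z. c b * newton (up j b) a) = (\<Sum>b\<in>{b\<in>Z. up j b \<in> Z}. c b * newton (up j b) a)"
    using finite_Z * by (intro sum.mono_neutral_right) auto
  also have "\<dots> = (\<Sum>b\<in>{b\<in>Z. b j \<noteq> 0}. c (down j b) * newton b a)"
    by (rule sum.reindex_bij_witness[of _ "down j" "up j"]) (auto simp: up_down down_in_Z)
  also have "\<dots> = interp (shift j c) a"
    unfolding interp_def shift_def using finite_Z by (intro sum.mono_neutral_cong_left) auto
  finally show ?thesis .
qed

lemma coordinate_mult_interp:
  assumes "j \<in> {1..r}" "a \<in> Z"
  shows "of_nat (a j) * interp c a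
    = interp (\<lambda>b. of_nat (b j) * c b + shift j c b :: 'k::field_char_0) a"
proof -
  have "of_nat (a j) * interp c a = (\<Sum>b\<in>Z. of_nat (b j) * c b * newton b a)
      + (\<Sum>b\<in>Z. c b * newton (up j b) a)"
    unfolding interp_def sum_distrib_left sum.distrib[symmetric]
    by (rule sum.cong) (simp_all add: newton_up[OF assms(1)] algebra_simps)
  then show ?thesis
    unfolding sum_shift[OF assms] by (simp add: interp_def sum.distrib algebra_simps)
qed

lemma interp_add: "interp (\<lambda>b. c b + c' b) a = interp c a + interp c' a"
  by (simp add: interp_def sum.distrib algebra_simps)

lemma interp_cmult: "interp (\<lambda>b. k * c b) a = k * interp c a"
  by (simp add: interp_def sum_distrib_left algebra_simps)

lemma interp_sum: "interp (\<lambda>b. \<Sum>j\<in>S. f j b) a = (\<Sum>j\<in>S. interp (f j) a)"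
  unfolding interp_def sum_distrib_right by (rule sum.swap)

text \<open>Multiplication by the linear form with coefficients \<open>k\<close>, on Newton
  coefficients. The diagonal entry at b is the value of the form at the point b itself; the
  remaining part raises \<open>size\<close> by one.\<close>

definition linear_op :: "(nat \<Rightarrow> 'k::field_char_0) \<Rightarrow> ((nat \<Rightarrow> nat) \<Rightarrow> 'k) \<Rightarrow> (nat \<Rightarrow> nat) \<Rightarrow> 'k" where
  "linear_op k c b = (\<Sum>j\<le>r. k j * point b j) * c b + (\<Sum>j\<in>{1..r}. k j * shift j c b)"

lemma sum_atMost_eq: "(\<Sum>j\<le>r. f j) = f 0 + (\<Sum>j\<in>{1..r}. f j)" for f :: "nat \<Rightarrow> 'b::comm_monoid_add"
proof -
  have "{..r} = insert 0 {1..r}" by auto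
  then show ?thesis by simp
qed

lemma linear_op:
  fixes k :: "nat \<Rightarrow> 'k::field_char_0"
  assumes "a \<in> Z"
  shows "(\<Sum>j\<le>r. k j * point a j) * interp c a = interp (linear_op k c) a"
proof -
  have "linear_op k c
      = (\<lambda>b. k 0 * c b + (\<Sum>j\<in>{1..r}. k j * (of_nat (b j) * c b + shift j c b)))"
    unfolding linear_op_def sum_atMost_eq
    by (auto simp: fun_eq_iff point_def sum.distrib sum_distrib_left algebra_simps)
  then have "interp (linear_op k c) a = k 0 * interp c a
      + (\<Sum>j\<in>{1..r}. k j * interp (\<lambda>b. of_nat (b j) * c b + shift j c b) a)"
    by (simp only: interp_add[of "\<lambda>b. k 0 * c b"] interp_sum interp_cmult)
  also have "\<dots> = k 0 * interp c a + (\<Sum>j\<in>{1..r}. k j * (of_nat (a j) * interp c a))"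
    using assms by (simp add: coordinate_mult_interp)
  also have "\<dots> = (\<Sum>j\<le>r. k j * point a j) * interp c a"
    unfolding sum_atMost_eq by (simp add: point_def sum_distrib_right distrib_right mult.assoc)
  finally show ?thesis by simp
qed

text \<open>Each \<open>shift\<close> reads the coefficient at \<open>down j b\<close>, one size
  smaller. Since the operator only looks downwards, it may be truncated to sizes below
  \<open>d\<close>.\<close>

lemma linear_op_triangular:
  assumes "\<And>a. a \<in> Z \<Longrightarrow> (\<Sum>j\<le>r. k j * point a j) \<noteq> (0::'k::field_char_0)"
  shows "triangular_operator {b\<in>Z. size b < d} size (\<lambda>b. \<Sum>j\<le>r. k j * point b j)
    (\<lambda>c b. \<Sum>j\<in>{1..r}. k j * shift j c b)"
proof
  fix b c c' assume b: "b \<in> {b\<in>Z. size b < d}"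
    and eq: "\<And>a. a \<in> {b\<in>Z. size b < d} \<Longrightarrow> size a < size b \<Longrightarrow> c a = (c' a :: 'k)"
  show "(\<Sum>j\<in>{1..r}. k j * shift j c b) = (\<Sum>j\<in>{1..r}. k j * shift j c' b)"
  proof (rule sum.cong)
    fix j assume j: "j \<in> {1..r}"
    have "c (down j b) = c' (down j b)" if "b j \<noteq> 0"
      using eq[of "down j b"] b j size_down[of j b] that by (auto simp: down_in_Z)
    then show "k j * shift j c b = k j * shift j c' b" by (simp add: shift_def)
  qed simp
qed (use assms in auto)

section \<open>Functions on the points given by forms of a fixed degree\<close>

definition value_space :: "nat \<Rightarrow> ((nat \<Rightarrow> nat) \<Rightarrow> 'k::field_char_0) set" where
  "value_space d = {u. \<exists>c. (\<forall>b. d < size b \<longrightarrow> c b = 0) \<and> (\<forall>a\<in>Z. u a = interp c a)}"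

lemma value_spaceI: "(\<And>b. d < size b \<Longrightarrow> c b = 0) \<Longrightarrow> (\<And>a. a \<in> Z \<Longrightarrow> u a = interp c a) \<Longrightarrow> u \<in> value_space d"
  by (auto simp: value_space_def)

lemma value_spaceE:
  assumes "u \<in> value_space d"
  obtains c where "\<And>b. d < size b \<Longrightarrow> c b = 0" "\<And>a. a \<in> Z \<Longrightarrow> u a = interp c a"
  using assms by (auto simp: value_space_def)

lemma value_space_zero: "(\<lambda>_. 0) \<in> value_space d"
  by (rule value_spaceI[of _ "\<lambda>_. 0"]) (auto simp: interp_def)

lemma value_space_add: "u \<in> value_space d \<Longrightarrow> v \<in> value_space d \<Longrightarrow> (\<lambda>a. u a + v a) \<in> value_space d"
proof (elim value_spaceE)
  fix c c' assume "\<And>b. d < size b \<Longrightarrow> c b = 0" "\<And>a. a \<in> Z \<Longrightarrow> u a = interp c a"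
    "\<And>b. d < size b \<Longrightarrow> c' b = 0" "\<And>a. a \<in> Z \<Longrightarrow> v a = interp c' a"
  then show ?thesis by (intro value_spaceI[of _ "\<lambda>b. c b + c' b"]) (auto simp: interp_add)
qed

lemma value_space_cmult: "u \<in> value_space d \<Longrightarrow> (\<lambda>a. k * u a) \<in> value_space d"
proof (elim value_spaceE)
  fix c assume "\<And>b. d < size b \<Longrightarrow> c b = 0" "\<And>a. a \<in> Z \<Longrightarrow> u a = interp c a"
  then show ?thesis by (intro value_spaceI[of _ "\<lambda>b. k * c b"]) (auto simp: interp_cmult)
qed

lemma value_space_sum: "(\<And>s. s \<in> S \<Longrightarrow> u s \<in> value_space d) \<Longrightarrow> (\<lambda>a. \<Sum>s\<in>S. u s a) \<in> value_space d"
  by (induction S rule: infinite_finite_induct) (auto intro: value_space_add value_space_zero)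

lemma value_space_one: "(\<lambda>_. 1 :: 'k::field_char_0) \<in> value_space d"
proof (rule value_spaceI)
  fix a assume "a \<in> Z"
  have "interp (\<lambda>b. if b = (\<lambda>_. 0) then 1 else 0 :: 'k) a = newton (\<lambda>_. 0) a"
    unfolding interp_def using finite_Z zero_in_Z
    by (subst sum.mono_neutral_right[of Z "{\<lambda>_. 0}"]) auto
  then show "1 = interp (\<lambda>b. if b = (\<lambda>_. 0) then 1 else 0 :: 'k) a"
    by (simp add: newton_def)
qed (auto simp: size_def)

text \<open>The coordinate x_0 equals 1 on all points, so it keeps the coefficients; any other
  coordinate moves them up by at most one size.\<close>

lemma value_space_coordinate:
  assumes "u \<in> value_space d" "i \<le> r"
  shows "(\<lambda>a. u a * point a i :: 'k::field_char_0) \<in> value_space (Suc d)"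
proof -
  obtain c where c: "\<And>b. d < size b \<Longrightarrow> c b = 0" "\<And>a. a \<in> Z \<Longrightarrow> u a = interp c a"
    using assms(1) by (auto simp: value_space_def)
  show ?thesis
  proof (cases "i = 0")
    case True
    with c show ?thesis by (intro value_spaceI[of _ c]) (auto simp: point_def)
  next
    case False
    then have i: "i \<in> {1..r}" using assms by auto
    show ?thesis
    proof (rule value_spaceI)
      fix a assume "a \<in> Z"
      then show "u a * point a i = interp (\<lambda>b. of_nat (b i) * c b + shift i c b) a"
        using False c(2) coordinate_mult_interp[OF i, of a c] by (simp add: point_def mult.commute)
    next
      fix b assume "Suc d < size b"
      with c(1) size_down[OF i, of b] show "of_nat (b i) * c b + shift i c b = 0"
        by (auto simp: shift_def)
    qed
  qed
qed

lemma value_space_coordinate_power: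
  assumes "u \<in> value_space d" "i \<le> r"
  shows "(\<lambda>a. u a * point a i ^ n :: 'k::field_char_0) \<in> value_space (d + n)"
proof (induction n)
  case (Suc n)
  then show ?case using value_space_coordinate[OF Suc.IH assms(2)] by (simp add: mult_ac)
qed (use assms in simp)

lemma value_space_mono_at:
  assumes "keys m \<subseteq> {..r}" "weight m = d"
  shows "(\<lambda>a. mono_at (point a) m :: 'k::field_char_0) \<in> value_space d"
proof -
  have "(\<lambda>a. \<Prod>i\<in>S. point a i ^ lookup m i :: 'k) \<in> value_space (\<Sum>i\<in>S. lookup m i)"
    if "finite S" "S \<subseteq> {..r}" for S
    using that
  proof (induction S)
    case (insert i S)
    then have "(\<lambda>a. (\<Prod>i\<in>S. point a i ^ lookup m i) * point a i ^ lookup m i :: 'k)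
        \<in> value_space (sum (lookup m) S + lookup m i)"
      by (intro value_space_coordinate_power) auto
    with insert show ?case by (simp add: mult.commute[of "point _ i ^ _"] add.commute[of "lookup m i"])
  qed (simp add: value_space_one)
  from this[OF _ assms(1)] assms(2) show ?thesis
    by (simp add: mono_at_def weight_def)
qed

text \<open>Together with \<open>value_space_form\<close> this shows that, on \<open>Z\<close>, the
  functions in \<open>value_space d\<close> are exactly those given by forms of degree d.\<close>

lemma form_values:
  assumes "f \<in> forms r d" shows "(\<lambda>a. val (point a) f :: 'k::field_char_0) \<in> value_space d"
proof -
  have "(\<lambda>a. val (point a) f) = (\<lambda>a. \<Sum>m\<in>keys f. lookup f m * mono_at (point a) m :: 'k)"
    by (subst sum_single_keys[of f]) simp
  also have "\<dots> \<in> value_space d"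
    using assms by (intro value_space_sum value_space_cmult value_space_mono_at) (auto simp: forms_iff)
  finally show ?thesis .
qed

definition newton_form :: "(nat \<Rightarrow> nat) \<Rightarrow> 'k::field_char_0 mpoly" where
  "newton_form b = (\<Prod>j\<in>{1..r}. \<Prod>t<b j. var j - single 0 (of_nat t) * var 0)"

lemma const_mult_in_forms [intro]:
  assumes "f \<in> forms r d" shows "single 0 k * f \<in> forms r d"
proof -
  have "single 0 k \<in> forms r 0" by (rule single_in_forms) auto
  from forms_mult[OF this assms] show ?thesis by simp
qed

lemma newton_form_in_forms: "newton_form b \<in> forms r (size b)"
proof -
  have "(\<Prod>t<b j. var j - single 0 (of_nat t) * var 0) \<in> forms r (\<Sum>t<b j. Suc 0)"
    if "j \<in> {1..r}" for j
    using that by (intro forms_prod forms_diff const_mult_in_forms var_in_forms) auto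
  then show ?thesis unfolding newton_form_def size_def by (intro forms_prod) simp
qed

lemma val_newton_form [simp]: "val (point a) (newton_form b) = newton b a"
  unfolding newton_form_def newton_def val_simps
  by (intro prod.cong) (auto simp: point_def)

lemma value_space_form:
  assumes "u \<in> value_space d"
  obtains f :: "'k::field_char_0 mpoly" where "f \<in> forms r d" "\<And>a. a \<in> Z \<Longrightarrow> val (point a) f = u a"
proof -
  obtain c where c: "\<And>b. d < size b \<Longrightarrow> c b = 0" "\<And>a. a \<in> Z \<Longrightarrow> u a = interp c a"
    using assms by (auto simp: value_space_def)
  \<comment> \<open>The power of x_0 pads each Newton form to degree \<open>d\<close> without
    changing its values, because x_0 = 1 on the points.\<close>
  define f where "f = (\<Sum>b\<in>{b\<in>Z. size b \<le> d}. single 0 (c b) * (newton_form b * var 0 ^ (d - size b)))"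
  show thesis
  proof
    have "newton_form b * var 0 ^ (d - size b) \<in> forms r d" if "size b \<le> d" for b
      using forms_mult[OF newton_form_in_forms forms_power[OF var_in_forms], of 0 b "d - size b"] that
      by simp
    then show "f \<in> forms r d" unfolding f_def by (intro forms_sum const_mult_in_forms) auto
    fix a assume "a \<in> Z"
    have "val (point a) f = (\<Sum>b\<in>{b\<in>Z. size b \<le> d}. c b * newton b a)"
      by (simp add: f_def point_def)
    also have "\<dots> = interp c a"
      unfolding interp_def using finite_Z c(1) by (intro sum.mono_neutral_left) (auto simp: not_le)
    finally show "val (point a) f = u a" using c(2) \<open>a \<in> Z\<close> by simp
  qed
qed

end

section \<open>Vanishing ideals of finite sets of points\<close>

definition double_coset ::
    "('a, 'm) ring_scheme \<Rightarrow> 'a set \<Rightarrow> 'a \<Rightarrow> 'a \<Rightarrow> 'a set set" where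
  "double_coset R I s f =
     (PIdl\<^bsub>R Quot I\<^esub> (I +>\<^bsub>R\<^esub> s)) +>\<^bsub>R Quot I\<^esub> (I +>\<^bsub>R\<^esub> f)"

lemma carrier_Quot: "carrier (R Quot I) = (\<lambda>a. I +>\<^bsub>R\<^esub> a) ` carrier R"
  by (auto simp: FactRing_def A_RCOSETS_def')

context
  fixes R :: "('a, 'm) ring_scheme" (structure) and I s
  assumes R: "cring R" and I: "ideal I R" and s: "s \<in> carrier R"
begin

interpretation cring R by (rule R)

lemma quotient_cring: "cring (R Quot I)"
  by (rule ideal.quotient_is_cring[OF I R])

lemma quotient_generator: "I +> s \<in> carrier (R Quot I)"
  using s by (simp add: carrier_Quot)

lemma double_quotient_ideal: "ideal (PIdl\<^bsub>R Quot I\<^esub> (I +> s)) (R Quot I)"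
  by (rule cring.cgenideal_ideal[OF quotient_cring quotient_generator])

lemma double_quotient_cring: "cring (R Quot I Quot (PIdl\<^bsub>R Quot I\<^esub> (I +> s)))"
  by (rule ideal.quotient_is_cring[OF double_quotient_ideal quotient_cring])

lemma double_coset_hom:
  "ring_hom_ring R (R Quot I Quot (PIdl\<^bsub>R Quot I\<^esub> (I +> s))) (double_coset R I s)"
proof (rule ring_hom_ringI2)
  have "double_coset R I s = (\<lambda>x. PIdl\<^bsub>R Quot I\<^esub> (I +> s) +>\<^bsub>R Quot I\<^esub> x) \<circ> (\<lambda>x. I +> x)"
    by (simp add: double_coset_def fun_eq_iff)
  then show "double_coset R I s
      \<in> ring_hom R (R Quot I Quot (PIdl\<^bsub>R Quot I\<^esub> (I +> s)))"
    using ring_hom_trans[OF ideal.rcos_ring_hom[OF I] ideal.rcos_ring_hom[OF double_quotient_ideal]]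
    by simp
qed (auto intro: ring_axioms cring.axioms(1) double_quotient_cring)

lemma double_coset_surj:
  "carrier (R Quot I Quot (PIdl\<^bsub>R Quot I\<^esub> (I +> s))) = double_coset R I s ` carrier R"
  by (simp add: carrier_Quot double_coset_def image_image)

text \<open>The class of f lies in the principal ideal of the class of s iff f agrees with a
  multiple of s modulo I. This turns computations with cosets of cosets into computations with
  polynomials.\<close>

lemma double_coset_eq_zero_iff:
  assumes f: "f \<in> carrier R"
  shows "double_coset R I s f = \<zero>\<^bsub>R Quot I Quot (PIdl\<^bsub>R Quot I\<^esub> (I +> s))\<^esub>
    \<longleftrightarrow> (\<exists>q\<in>carrier R. f \<ominus> q \<otimes> s \<in> I)"
proof -
  interpret A: cring "R Quot I" by (rule quotient_cring)
  interpret J: ideal "PIdl\<^bsub>R Quot I\<^esub> (I +> s)" "R Quot I" by (rule double_quotient_ideal)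
  have f': "I +> f \<in> carrier (R Quot I)" using f by (simp add: carrier_Quot)
  have "double_coset R I s f = \<zero>\<^bsub>R Quot I Quot (PIdl\<^bsub>R Quot I\<^esub> (I +> s))\<^esub>
      \<longleftrightarrow> I +> f \<in> PIdl\<^bsub>R Quot I\<^esub> (I +> s)"
    using J.rcos_const_imp_mem[OF f'] A.a_rcos_zero[OF double_quotient_ideal, of "I +> f"]
    by (auto simp: double_coset_def FactRing_def)
  also have "\<dots> \<longleftrightarrow> (\<exists>q\<in>carrier R. I +> f = (I +> q) \<otimes>\<^bsub>R Quot I\<^esub> (I +> s))"
    by (auto simp: cgenideal_def carrier_Quot)
  also have "\<dots> \<longleftrightarrow> (\<exists>q\<in>carrier R. I +> f = I +> (q \<otimes> s))"
    using ring_hom_mult[OF ideal.rcos_ring_hom[OF I]] s by auto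
  also have "\<dots> \<longleftrightarrow> (\<exists>q\<in>carrier R. f \<ominus> q \<otimes> s \<in> I)"
    using quotient_eq_iff_same_a_r_cos[OF I f] s by auto
  finally show ?thesis .
qed

end

section \<open>The polynomial ring in type class notation\<close>

lemma mpoly_ring_a_inv:
  assumes "f \<in> carrier (mpoly_ring r)" shows "\<ominus>\<^bsub>mpoly_ring r\<^esub> f = - f"
proof -
  interpret cring "mpoly_ring r" by (rule cring_mpoly_ring)
  have "- f \<in> carrier (mpoly_ring r)"
    using assms by (auto simp: mpoly_ring_def in_keys_iff)
  with assms show ?thesis using minus_equality[of "- f" f] by simp
qed

lemma mpoly_ring_minus:
  "f \<in> carrier (mpoly_ring r) \<Longrightarrow> g \<in> carrier (mpoly_ring r) \<Longrightarrow> f \<ominus>\<^bsub>mpoly_ring r\<^esub> g = f - g"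
  by (simp add: a_minus_def mpoly_ring_a_inv)

lemma mpoly_ring_power: "f [^]\<^bsub>mpoly_ring r\<^esub> (n::nat) = f ^ n"
  by (induction n) (auto simp: monoid.nat_pow_0 nat_pow_def mult.commute)

lemma carrier_mpoly_closed:
  assumes "f \<in> carrier (mpoly_ring r)" "g \<in> carrier (mpoly_ring r)"
  shows "f + g \<in> carrier (mpoly_ring r)" "f * g \<in> carrier (mpoly_ring r)"
    "f - g \<in> carrier (mpoly_ring r)" "- f \<in> carrier (mpoly_ring r)"
proof -
  interpret cring "mpoly_ring r" by (rule cring_mpoly_ring)
  show "f + g \<in> carrier (mpoly_ring r)" "f * g \<in> carrier (mpoly_ring r)"
    "f - g \<in> carrier (mpoly_ring r)" "- f \<in> carrier (mpoly_ring r)"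
    using assms a_closed[of f g] m_closed[of f g] minus_closed[of f g] a_inv_closed[of f]
    by (simp_all add: mpoly_ring_minus mpoly_ring_a_inv)
qed

lemma zero_one_carrier_mpoly [simp]: "0 \<in> carrier (mpoly_ring r)" "1 \<in> carrier (mpoly_ring r)"
  by (auto simp: mpoly_ring_def)

text \<open>Vanishing is required along the whole line through p, not only at p. Thus an
  inhomogeneous f belongs to the ideal only if each of its components vanishes at p.\<close>

definition vanishing_ideal :: "nat \<Rightarrow> (nat \<Rightarrow> 'k::field) set \<Rightarrow> 'k mpoly set" where
  "vanishing_ideal r Y = {f \<in> carrier (mpoly_ring r). \<forall>p\<in>Y. on_line p f = 0}"

lemma vanishing_idealI:
  "f \<in> carrier (mpoly_ring r) \<Longrightarrow> (\<And>p. p \<in> Y \<Longrightarrow> on_line p f = 0) \<Longrightarrow> f \<in> vanishing_ideal r Y"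
  by (simp add: vanishing_ideal_def)

lemma vanishing_idealD:
  assumes "f \<in> vanishing_ideal r Y"
  shows "f \<in> carrier (mpoly_ring r)" "p \<in> Y \<Longrightarrow> on_line p f = 0"
  using assms by (auto simp: vanishing_ideal_def)

lemma form_in_vanishing_ideal_iff:
  "f \<in> forms r d \<Longrightarrow> f \<in> vanishing_ideal r Y \<longleftrightarrow> (\<forall>p\<in>Y. val p f = 0)"
  by (auto simp: vanishing_ideal_def on_line_form monom_eq_0_iff)

lemma ideal_vanishing_ideal: "ideal (vanishing_ideal r Y) (mpoly_ring r)"
proof (rule idealI)
  show "subgroup (vanishing_ideal r Y) (add_monoid (mpoly_ring r))"
  proof (rule subgroup.intro)
    fix f assume "f \<in> vanishing_ideal r Y"
    moreover from this have "inv\<^bsub>add_monoid (mpoly_ring r)\<^esub> f = - f"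
      using mpoly_ring_a_inv[of f r] by (simp add: vanishing_ideal_def a_inv_def)
    ultimately show "inv\<^bsub>add_monoid (mpoly_ring r)\<^esub> f \<in> vanishing_ideal r Y"
      by (auto simp: vanishing_ideal_def carrier_mpoly_closed)
  qed (auto simp: vanishing_ideal_def carrier_mpoly_closed)
qed (auto simp: vanishing_ideal_def carrier_mpoly_closed intro: cring.axioms(1) cring_mpoly_ring)

text \<open>The components of a member are again members by \<open>val_component\<close>, and they
  sum to it.\<close>

lemma homogeneous_vanishing_ideal:
  "homogeneous_ideal (mpoly_ring r) (forms r) (vanishing_ideal r Y)"
  unfolding homogeneous_ideal_def
proof (intro conjI exI)
  interpret cring "mpoly_ring r" by (rule cring_mpoly_ring)
  let ?S = "vanishing_ideal r Y \<inter> (\<Union>d. forms r d)"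
  have S: "?S \<subseteq> carrier (mpoly_ring r)" by (auto dest: vanishing_idealD)
  interpret G: ideal "Idl\<^bsub>mpoly_ring r\<^esub> ?S" "mpoly_ring r" by (rule genideal_ideal[OF S])
  show "vanishing_ideal r Y = Idl\<^bsub>mpoly_ring r\<^esub> ?S"
  proof
    show "Idl\<^bsub>mpoly_ring r\<^esub> ?S \<subseteq> vanishing_ideal r Y"
      by (rule genideal_minimal[OF ideal_vanishing_ideal]) simp
    show "vanishing_ideal r Y \<subseteq> Idl\<^bsub>mpoly_ring r\<^esub> ?S"
    proof
      fix f assume f: "f \<in> vanishing_ideal r Y"
      have comp: "component d f \<in> Idl\<^bsub>mpoly_ring r\<^esub> ?S" for d
      proof -
        have "component d f \<in> forms r d" using f by (auto dest: vanishing_idealD)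
        moreover from this f have "component d f \<in> vanishing_ideal r Y"
          by (simp add: form_in_vanishing_ideal_iff val_component vanishing_idealD)
        ultimately show ?thesis using genideal_self[OF S] by blast
      qed
      have "(\<Sum>d\<in>D. component d f) \<in> Idl\<^bsub>mpoly_ring r\<^esub> ?S" if "finite D" for D
        using that
      proof (induction D)
        case empty
        then show ?case using G.zero_closed by simp
      next
        case (insert d D)
        then show ?case using G.a_closed[OF comp, of "\<Sum>d\<in>D. component d f" d] by simp
      qed
      from this[of "weight ` keys f"] show "f \<in> Idl\<^bsub>mpoly_ring r\<^esub> ?S"
        by (simp add: sum_components[symmetric])
    qed
  qed
qed (auto intro: ideal_vanishing_ideal)

text \<open>The ideal is the kernel of \<open>on_line p\<close>, a homomorphism into a
  domain.\<close>

lemma primeideal_vanishing_ideal: "primeideal (vanishing_ideal r {p}) (mpoly_ring r)"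
proof (rule primeidealI)
  have "1 \<notin> vanishing_ideal r {p}" by (auto dest: vanishing_idealD)
  then show "carrier (mpoly_ring r) \<noteq> vanishing_ideal r {p}"
    by (metis zero_one_carrier_mpoly(2))
next
  fix f g assume "f \<in> carrier (mpoly_ring r)" "g \<in> carrier (mpoly_ring r)"
    "f \<otimes>\<^bsub>mpoly_ring r\<^esub> g \<in> vanishing_ideal r {p}"
  then show "f \<in> vanishing_ideal r {p} \<or> g \<in> vanishing_ideal r {p}"
    by (simp add: vanishing_ideal_def)
qed (rule ideal_vanishing_ideal cring_mpoly_ring)+

text \<open>Testing with the form x_0^n suffices: on each line it restricts to t^n, which can be
  cancelled.\<close>

lemma saturated_vanishing_ideal:
  assumes "\<And>p. p \<in> Y \<Longrightarrow> p 0 = 1"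
  shows "saturated r (vanishing_ideal r Y)"
  unfolding saturated_def
proof (intro ballI impI, elim exE)
  fix f n assume f: "f \<in> carrier (mpoly_ring r)"
    and n: "\<forall>g\<in>forms r n. g \<otimes>\<^bsub>mpoly_ring r\<^esub> f \<in> vanishing_ideal r Y"
  have "var 0 ^ n \<in> forms r n" using forms_power[OF var_in_forms, of 0 r n] by simp
  with n have *: "var 0 ^ n * f \<in> vanishing_ideal r Y" by auto
  show "f \<in> vanishing_ideal r Y"
  proof (rule vanishing_idealI[OF f])
    fix p assume p: "p \<in> Y"
    from vanishing_idealD(2)[OF * p] assms[OF p] show "on_line p f = 0"
      by (simp add: monom_eq_0_iff)
  qed
qed

lemma reduced_vanishing_ideal:
  assumes "Y \<noteq> {}"
  shows "reduced_ring (coord_ring r (vanishing_ideal r Y))"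
  unfolding reduced_ring_def coord_ring_def
proof (intro ballI allI impI)
  let ?I = "vanishing_ideal r Y"
  interpret cring "mpoly_ring r" by (rule cring_mpoly_ring)
  interpret ideal ?I "mpoly_ring r" by (rule ideal_vanishing_ideal)
  interpret h: ring_hom_ring "mpoly_ring r" "mpoly_ring r Quot ?I" "(+>\<^bsub>mpoly_ring r\<^esub>) ?I"
    by (rule rcos_ring_hom_ring)
  fix a and n :: nat
  assume "a \<in> carrier (mpoly_ring r Quot ?I)"
    and a: "a [^]\<^bsub>mpoly_ring r Quot ?I\<^esub> n = \<zero>\<^bsub>mpoly_ring r Quot ?I\<^esub>"
  then obtain f where f: "f \<in> carrier (mpoly_ring r)" "a = ?I +>\<^bsub>mpoly_ring r\<^esub> f"
    by (auto simp: carrier_Quot)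
  have "f ^ n \<in> carrier (mpoly_ring r)"
    using nat_pow_closed[OF f(1), of n] by (simp add: mpoly_ring_power)
  moreover have "?I +>\<^bsub>mpoly_ring r\<^esub> (f ^ n) = \<zero>\<^bsub>mpoly_ring r Quot ?I\<^esub>"
    using a f h.hom_nat_pow[OF f(1), of n] by (simp add: mpoly_ring_power)
  ultimately have "f ^ n \<in> ?I"
    by (intro rcos_const_imp_mem) (simp_all add: FactRing_def)
  then have "on_line p f = 0" if "p \<in> Y" for p
    using vanishing_idealD(2)[of "f ^ n" r Y p] that by simp
  then have "f \<in> ?I" by (intro vanishing_idealI f)
  then show "a = \<zero>\<^bsub>mpoly_ring r Quot ?I\<^esub>"
    using f a_rcos_zero[OF ideal_vanishing_ideal] by (simp add: FactRing_def)
qed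

text \<open>If P contained none of the ideals of the points, multiplying suitable elements outside P
  would give an element of the ideal of \<open>Y\<close> outside P. For empty \<open>Y\<close> that
  ideal is the whole ring, which no prime contains.\<close>

lemma prime_contains_point:
  assumes "finite Y" "primeideal P (mpoly_ring r)" "vanishing_ideal r Y \<subseteq> P"
  shows "\<exists>p\<in>Y. vanishing_ideal r {p} \<subseteq> P"
  using assms(1,3)
proof (induction Y)
  case empty
  interpret primeideal P "mpoly_ring r" by fact
  have "carrier (mpoly_ring r) \<subseteq> P" using empty by (simp add: vanishing_ideal_def)
  with I_notcarr a_subset show ?case by blast
next
  case (insert p Y)
  interpret primeideal P "mpoly_ring r" by fact
  show ?case
  proof (rule ccontr)
    assume *: "\<not> ?case"
    then obtain f where f: "f \<in> vanishing_ideal r {p}" "f \<notin> P" by auto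
    from * insert.IH obtain g where g: "g \<in> vanishing_ideal r Y" "g \<notin> P" by auto
    have "f * g \<in> vanishing_ideal r (insert p Y)"
      using f g by (auto simp: vanishing_ideal_def carrier_mpoly_closed)
    with insert.prems have "f * g \<in> P" by blast
    with f g I_prime[of f g] show False by (auto dest: vanishing_idealD(1))
  qed
qed

text \<open>Modulo the ideal of p, a form g of degree n is g(p) x_0^n. If P were larger, it would
  contain a form not vanishing at p, hence x_0, hence all forms of positive degree.\<close>

lemma proj_zero_eq_vanishing_ideal:
  assumes "p 0 = 1" "P \<in> proj_zeros r J" "vanishing_ideal r {p} \<subseteq> P"
  shows "P = vanishing_ideal r {p}"
proof (rule ccontr)
  assume neq: "P \<noteq> vanishing_ideal r {p}"
  interpret primeideal P "mpoly_ring r" using assms(2) by (simp add: proj_zeros_def)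
  obtain S where S: "S \<subseteq> (\<Union>d. forms r d)" "P = Idl\<^bsub>mpoly_ring r\<^esub> S"
    using assms(2) by (auto simp: proj_zeros_def homogeneous_ideal_def)
  \<comment> \<open>Working with homogeneous generators of P yields an element outside the ideal of
    p that is itself a form.\<close>
  have "\<not> S \<subseteq> vanishing_ideal r {p}"
    using genideal_minimal[OF ideal_vanishing_ideal, of S "{p}"] S(2) assms(3) neq by auto
  then obtain f d where f: "f \<in> S" "f \<in> forms r d" "f \<notin> vanishing_ideal r {p}"
    using S(1) by blast
  have "f \<in> P" using genideal_self[of S] S f by auto
  have pow: "var 0 ^ d \<in> forms r d" for d using forms_power[OF var_in_forms, of 0 r d] by simp
  have reduce: "g - single 0 (val p g) * var 0 ^ n \<in> P" if "g \<in> forms r n" for g n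
  proof -
    have "single 0 (val p g) * var 0 ^ n \<in> forms r n"
      using forms_mult[of "single 0 (val p g)" r 0, OF _ pow[of n]] by (auto simp: single_in_forms)
    then have "g - single 0 (val p g) * var 0 ^ n \<in> forms r n" using that by blast
    then have "g - single 0 (val p g) * var 0 ^ n \<in> vanishing_ideal r {p}"
      by (simp add: form_in_vanishing_ideal_iff assms(1))
    with assms(3) show ?thesis by blast
  qed
  have c: "val p f \<noteq> 0" using f by (simp add: form_in_vanishing_ideal_iff)
  have const: "single 0 k \<in> carrier (mpoly_ring r)" for k :: 'a
    by (rule forms_carrier[of _ _ 0]) auto
  note add_closed = additive_subgroup.a_closed[OF additive_subgroup_axioms]
  have diff_closed: "g - h \<in> P" if "g \<in> P" "h \<in> P" for g h
    using that add_closed[OF that(1) additive_subgroup.a_inv_closed[OF additive_subgroup_axioms that(2)]] mpoly_ring_a_inv[of h r] Icarr[of h]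
    by simp
  have "f - (f - single 0 (val p f) * var 0 ^ d) \<in> P"
    using \<open>f \<in> P\<close> reduce[OF f(2)] by (rule diff_closed)
  then have "single 0 (inverse (val p f)) * (single 0 (val p f) * var 0 ^ d) \<in> P"
    using I_l_closed[OF _ const] by simp
  moreover have "single 0 (inverse (val p f)) * (single 0 (val p f) * var 0 ^ d) = (var 0 ^ d :: 'a mpoly)"
    using c by (simp add: mult.assoc[symmetric] mult_single)
  ultimately have "var 0 ^ d \<in> P" by metis
  have one: "1 \<notin> P" using one_imp_carrier I_notcarr by auto
  \<comment> \<open>Primality extracts x_0 from its power; degree 0 is excluded because P does not
    contain 1.\<close>
  have "var 0 \<in> P"
    using \<open>var 0 ^ d \<in> P\<close>
  proof (induction d)
    case (Suc d)
    then show ?case using I_prime[OF forms_carrier[OF var_in_forms] forms_carrier[OF pow], of 0 d] by auto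
  qed (use one in simp)
  have "forms r d \<subseteq> P" if "d \<ge> 1" for d
  proof
    fix g :: "'a mpoly" assume g: "g \<in> forms r d"
    have "var 0 ^ d = var 0 ^ (d - 1) * (var 0 :: 'a mpoly)"
      using that by (metis power_minus_mult le_zero_eq not_gr0 zero_neq_one)
    then have "single 0 (val p g) * var 0 ^ d \<in> P"
      using I_l_closed[OF I_l_closed[OF \<open>var 0 \<in> P\<close> forms_carrier[OF pow[of "d - 1"]]] const, of "val p g"]
      by simp
    from add_closed[OF reduce[OF g] this] show "g \<in> P" by simp
  qed
  then have "irrelevant_ideal (mpoly_ring r) (forms r) \<subseteq> P"
    unfolding irrelevant_ideal_def by (intro genideal_minimal is_ideal) auto
  with assms(2) show False by (simp add: proj_zeros_def)
qed

text \<open>Every relevant homogeneous prime over the ideal of \<open>Y\<close> is the ideal of one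
  of its points. For nested primes the same point serves for both, so they coincide.\<close>

lemma reduced_point_set_vanishing_ideal:
  assumes "finite Y" "Y \<noteq> {}" "\<And>p. p \<in> Y \<Longrightarrow> p 0 = 1"
  shows "reduced_point_set r (vanishing_ideal r Y)"
  unfolding reduced_point_set_def zero_dimensional_def
proof (intro conjI ballI impI)
  let ?I = "vanishing_ideal r Y"
  interpret cring "mpoly_ring r" by (rule cring_mpoly_ring)
  obtain p where p: "p \<in> Y" using assms by blast
  have "var 0 \<in> irrelevant_ideal (mpoly_ring r) (forms r)"
    unfolding irrelevant_ideal_def
    by (rule subsetD[OF genideal_self]) (auto intro!: bexI[of _ 1] var_in_forms)
  moreover have "var 0 \<notin> vanishing_ideal r {p}"
    using form_in_vanishing_ideal_iff[OF var_in_forms, of 0 r "{p}"] assms(3)[OF p] by simp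
  moreover have "?I \<subseteq> vanishing_ideal r {p}" using p by (auto simp: vanishing_ideal_def)
  ultimately have "vanishing_ideal r {p} \<in> proj_zeros r ?I"
    unfolding proj_zeros_def
    using primeideal_vanishing_ideal homogeneous_vanishing_ideal by blast
  then show "proj_zeros r ?I \<noteq> {}" by blast
  fix P Q assume P: "P \<in> proj_zeros r ?I" and Q: "Q \<in> proj_zeros r ?I" and "P \<subseteq> Q"
  obtain q where q: "q \<in> Y" "vanishing_ideal r {q} \<subseteq> P"
    using prime_contains_point[OF assms(1), of P r] P by (auto simp: proj_zeros_def)
  have "P = vanishing_ideal r {q}" "Q = vanishing_ideal r {q}"
    using proj_zero_eq_vanishing_ideal[OF assms(3)[OF q(1)] P q(2)]
      proj_zero_eq_vanishing_ideal[OF assms(3)[OF q(1)] Q order_trans[OF q(2) \<open>P \<subseteq> Q\<close>]]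
    by blast+
  then show "P = Q" by simp
next
  show "reduced_ring (coord_ring r (vanishing_ideal r Y))"
    by (rule reduced_vanishing_ideal[OF assms(2)])
next
  show "saturated r (vanishing_ideal r Y)"
    by (rule saturated_vanishing_ideal) (rule assms(3))
qed (rule homogeneous_vanishing_ideal)

section \<open>Artinian reductions of lower sets of points\<close>

text \<open>A monomial of weight 1 is a single variable, so the coefficients can be read
  off.\<close>

lemma linear_form_val:
  assumes "f \<in> forms r 1"
  obtains k where "\<And>p. val p f = (\<Sum>j\<le>r. k j * p j)"
proof
  fix p
  have "m \<in> (\<lambda>j. single j 1) ` {..r}" if m: "m \<in> keys f" for m
  proof -
    from assms m have "weight m = Suc 0" "keys m \<subseteq> {..r}" by (auto simp: forms_iff)
    then obtain i where i: "i \<in> keys m" "lookup m i = Suc 0" "\<forall>j\<in>keys m. i \<noteq> j \<longrightarrow> lookup m j = 0"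
      using sum_eq_Suc0_iff[of "keys m" "lookup m"] by (auto simp: weight_def)
    then have "m = single i 1"
      by (intro poly_mapping_eqI) (auto simp: lookup_single when_def in_keys_iff)
    with i \<open>keys m \<subseteq> {..r}\<close> show ?thesis by auto
  qed
  then have sub: "keys f \<subseteq> (\<lambda>j. single j 1) ` {..r}" by blast
  have inj: "inj_on (\<lambda>j. single j (1::nat)) {..r}"
    by (rule inj_onI) (metis keys_single singleton_inject zero_neq_one)
  have "val p f = (\<Sum>m\<in>keys f. lookup f m * mono_at p m)"
    by (subst sum_single_keys[of f]) simp
  also have "\<dots> = (\<Sum>m\<in>(\<lambda>j. single j 1) ` {..r}. lookup f m * mono_at p m)"
    using sub by (intro sum.mono_neutral_left) (auto simp: in_keys_iff)
  also have "\<dots> = (\<Sum>j\<le>r. lookup f (single j 1) * p j)"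
    by (subst sum.reindex[OF inj]) simp
  finally show "val p f = (\<Sum>j\<le>r. lookup f (single j 1) * p j)" .
qed

text \<open>Nonzero constants are invertible. The image of this subfield is the field of scalars
  over which the h-vector is computed.\<close>

lemma subfield_forms_0: "subfield (forms r 0 :: 'k::field mpoly set) (mpoly_ring r)"
proof -
  let ?R = "mpoly_ring r :: 'k mpoly ring"
  interpret R: cring ?R by (rule cring_mpoly_ring)
  have sub: "subring (forms r 0 :: 'k mpoly set) ?R"
  proof (rule R.subringI)
    fix f g :: "'k mpoly" assume fg: "f \<in> forms r 0" "g \<in> forms r 0"
    show "\<ominus>\<^bsub>?R\<^esub> f \<in> forms r 0"
      using fg(1) by (subst mpoly_ring_a_inv) auto
    show "f \<otimes>\<^bsub>?R\<^esub> g \<in> forms r 0" "f \<oplus>\<^bsub>?R\<^esub> g \<in> forms r 0"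
      using forms_mult[OF fg] forms_add[OF fg] by simp_all
  qed (auto simp: forms_carrier)
  show ?thesis
  proof (rule R.subfieldI)
    show "subcring (forms r 0 :: 'k mpoly set) ?R"
      by (rule R.subcringI[OF sub]) (simp add: mult.commute)
    show "Units (?R\<lparr>carrier := forms r 0\<rparr>) = forms r 0 - {\<zero>\<^bsub>?R\<^esub>}"
    proof
      show "Units (?R\<lparr>carrier := forms r 0\<rparr>) \<subseteq> forms r 0 - {\<zero>\<^bsub>?R\<^esub>}"
        by (auto simp: Units_def mpoly_ring_def)
      show "forms r 0 - {\<zero>\<^bsub>?R\<^esub>} \<subseteq> Units (?R\<lparr>carrier := forms r 0\<rparr>)"
      proof
        fix f assume f: "f \<in> forms r 0 - {\<zero>\<^bsub>?R\<^esub>}"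
        then obtain c where c: "f = single 0 c" by (auto elim: zero_form_const)
        with f have "c \<noteq> 0" by auto
        then have "single 0 (inverse c) * f = 1" "f * single 0 (inverse c) = 1"
          by (simp_all add: c mult_single)
        moreover have "single 0 (inverse c) \<in> forms r 0" by (rule single_in_forms) auto
        ultimately show "f \<in> Units (?R\<lparr>carrier := forms r 0\<rparr>)"
          using f by (auto simp: Units_def)
      qed
    qed
  qed
qed

section \<open>Regular linear forms\<close>

context lower_set
begin

definition points_ideal :: "'k::field_char_0 mpoly set" where
  "points_ideal = vanishing_ideal r (point ` Z)"

text \<open>If s vanished at a, then multiplying s by a form that is 1 at a and 0 at the other
  points would give 0 in the coordinate ring, making s a zero divisor.\<close>

lemma regular_linear_form_nonvanishing:
  fixes l :: "'k::field_char_0 mpoly set"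
  assumes "l \<in> regular_linear_forms r points_ideal"
  obtains s where "s \<in> forms r 1" "l = points_ideal +>\<^bsub>mpoly_ring r\<^esub> s"
    "\<And>a. a \<in> Z \<Longrightarrow> val (point a) s \<noteq> 0"
proof -
  let ?I = "points_ideal :: 'k mpoly set"
  interpret R: cring "mpoly_ring r" by (rule cring_mpoly_ring)
  interpret I: ideal ?I "mpoly_ring r" unfolding points_ideal_def by (rule ideal_vanishing_ideal)
  obtain s where s: "s \<in> forms r 1" "l = ?I +>\<^bsub>mpoly_ring r\<^esub> s"
    using assms by (auto simp: regular_linear_forms_def coord_grading_def quot_grading_def)
  show thesis
  proof (rule that[OF s])
    fix a assume a: "a \<in> Z"
    show "val (point a) s \<noteq> 0"
    proof
      assume s0: "val (point a) s = 0"
      obtain c where c: "\<forall>b. b \<notin> Z \<longrightarrow> c b = 0"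
        "\<forall>b\<in>Z. interp c b = (if b = a then 1 else 0 :: 'k)"
        using interp_surj[of "\<lambda>b. if b = a then 1 else 0 :: 'k"] by blast
      \<comment> \<open>In a degree exceeding all sizes, every function on \<open>Z\<close> is given
        by a form.\<close>
      obtain d where "\<forall>b\<in>Z. size b < d"
        using finite_nat_set_iff_bounded[of "size ` Z"] finite_Z by auto
      with c have "(\<lambda>b. if b = a then 1 else 0 :: 'k) \<in> value_space d"
        by (intro value_spaceI[of _ c]) force+
      from value_space_form[OF this] obtain f where f: "f \<in> forms r d"
        "\<And>b. b \<in> Z \<Longrightarrow> val (point b) f = (if b = a then 1 else 0 :: 'k)"
        by blast
      have "s * f \<in> ?I"
        unfolding points_ideal_def form_in_vanishing_ideal_iff[OF forms_mult[OF s(1) f(1)]]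
        using f(2) s0 by auto
      then have "?I +>\<^bsub>mpoly_ring r\<^esub> (s * f) = \<zero>\<^bsub>mpoly_ring r Quot ?I\<^esub>"
        using R.a_rcos_zero[OF I.is_ideal] by (simp add: FactRing_def)
      then have "l \<otimes>\<^bsub>coord_ring r ?I\<^esub> (?I +>\<^bsub>mpoly_ring r\<^esub> f) = \<zero>\<^bsub>coord_ring r ?I\<^esub>"
        using ring_hom_mult[OF I.rcos_ring_hom, of s f] s f by (auto simp: coord_ring_def)
      moreover have "?I +>\<^bsub>mpoly_ring r\<^esub> f \<in> carrier (coord_ring r ?I)"
        using f(1) by (auto simp: coord_ring_def carrier_Quot)
      ultimately have "?I +>\<^bsub>mpoly_ring r\<^esub> f = \<zero>\<^bsub>coord_ring r ?I\<^esub>"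
        using assms by (auto simp: regular_linear_forms_def)
      then have "f \<in> ?I"
        using f(1) by (intro I.rcos_const_imp_mem) (auto simp: coord_ring_def FactRing_def)
      then have "val (point a) f = 0"
        unfolding points_ideal_def form_in_vanishing_ideal_iff[OF f(1)] using a by auto
      with f(2)[OF a] show False by simp
    qed
  qed
qed

end

text \<open>One representative \<open>s\<close> of a regular linear form, with its coefficients
  \<open>k\<close>. \<open>B\<close> and \<open>G\<close> below are the artinian reduction and its
  grading, and \<open>proj\<close> maps polynomials onto \<open>B\<close>.\<close>

locale lower_set_section = lower_set +
  fixes s :: "'k::field_char_0 mpoly" and k :: "nat \<Rightarrow> 'k"
  assumes s_form: "s \<in> forms r 1"
    and s_val: "val p s = (\<Sum>j\<le>r. k j * p j)"
    and s_nonzero: "a \<in> Z \<Longrightarrow> val (point a) s \<noteq> 0"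
begin

abbreviation "R \<equiv> mpoly_ring r :: 'k mpoly ring"

definition B :: "'k mpoly set set ring" where
  "B = R Quot points_ideal Quot (PIdl\<^bsub>R Quot points_ideal\<^esub> (points_ideal +>\<^bsub>R\<^esub> s))"

definition proj :: "'k mpoly \<Rightarrow> 'k mpoly set set" where
  "proj = double_coset R points_ideal s"

definition G :: "nat \<Rightarrow> 'k mpoly set set set" where
  "G i = proj ` forms r i"

lemma ideal_points_ideal: "ideal points_ideal R"
  unfolding points_ideal_def by (rule ideal_vanishing_ideal)

lemmas quotient_assms = cring_mpoly_ring[of r] ideal_points_ideal forms_carrier[OF s_form]

lemma cring_B: "cring B"
  unfolding B_def by (rule double_quotient_cring[OF quotient_assms])

sublocale B: cring B
  by (rule cring_B)

sublocale proj: ring_hom_ring R B proj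
  unfolding B_def proj_def by (rule double_coset_hom[OF quotient_assms])

lemma carrier_B: "carrier B = proj ` carrier R"
  unfolding B_def proj_def by (rule double_coset_surj[OF quotient_assms])

lemma proj_eq_zero_iff:
  assumes "f \<in> carrier R"
  shows "proj f = \<zero>\<^bsub>B\<^esub> \<longleftrightarrow> (\<exists>q\<in>carrier R. f - q * s \<in> points_ideal)"
proof -
  have "f \<ominus>\<^bsub>R\<^esub> q \<otimes>\<^bsub>R\<^esub> s = f - q * s" if "q \<in> carrier R" for q
    using that assms forms_carrier[OF s_form] by (simp add: mpoly_ring_minus carrier_mpoly_closed)
  then show ?thesis
    unfolding B_def proj_def double_coset_eq_zero_iff[OF quotient_assms assms] by auto
qed

lemma proj_add: "f \<in> carrier R \<Longrightarrow> g \<in> carrier R \<Longrightarrow> proj (f + g) = proj f \<oplus>\<^bsub>B\<^esub> proj g"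
  using proj.hom_add[of f g] by simp

lemma proj_mult: "f \<in> carrier R \<Longrightarrow> g \<in> carrier R \<Longrightarrow> proj (f * g) = proj f \<otimes>\<^bsub>B\<^esub> proj g"
  using proj.hom_mult[of f g] by simp

lemma proj_diff_eq_zero_iff:
  assumes "f \<in> carrier R" "g \<in> carrier R"
  shows "proj (f - g) = \<zero>\<^bsub>B\<^esub> \<longleftrightarrow> proj f = proj g"
proof
  assume "proj (f - g) = \<zero>\<^bsub>B\<^esub>"
  then show "proj f = proj g"
    using proj_add[of "f - g" g] assms by (simp add: carrier_mpoly_closed)
next
  assume "proj f = proj g"
  then show "proj (f - g) = \<zero>\<^bsub>B\<^esub>"
    using proj_add[of f "- g"] proj.hom_a_inv[of g] assms
    by (simp add: mpoly_ring_a_inv carrier_mpoly_closed B.r_neg)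
qed

lemma proj_zero: "proj 0 = \<zero>\<^bsub>B\<^esub>"
  using proj.hom_zero by simp

text \<open>If f = q s on the points, the degree d part of f is s times the degree d - 1 part of q,
  whose Newton coefficients live in sizes below d. For d = 0 there is no such part and u =
  0.\<close>

lemma proj_eq_zero_values:
  assumes f: "f \<in> carrier R" "proj f = \<zero>\<^bsub>B\<^esub>"
  shows "\<exists>u. (\<forall>b. d \<le> size b \<longrightarrow> u b = 0) \<and>
    (\<forall>a\<in>Z. coeff (on_line (point a) f) d = val (point a) s * interp u a)"
proof -
  obtain q where q: "q \<in> carrier R" "f - q * s \<in> points_ideal"
    using f proj_eq_zero_iff by blast
  have line: "on_line (point a) f = monom (val (point a) s) 1 * on_line (point a) q" if "a \<in> Z" for a
    using q(2) that on_line_form[OF s_form, of "point a"]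
    by (auto simp: points_ideal_def vanishing_ideal_def mult.commute)
  show ?thesis
  proof (cases d)
    case 0
    then show ?thesis
      by (intro exI[of _ "\<lambda>_. 0"]) (auto simp: line interp_def coeff_monom_mult)
  next
    case (Suc d')
    have "component d' q \<in> forms r d'" using q(1) by blast
    from form_values[OF this] obtain u where "\<And>b. d' < size b \<Longrightarrow> u b = 0"
      "\<And>a. a \<in> Z \<Longrightarrow> coeff (on_line (point a) q) d' = interp u a"
      by (auto simp: value_space_def val_component)
    with Suc show ?thesis
      by (intro exI[of _ u]) (auto simp: line coeff_monom_mult)
  qed
qed

text \<open>A converse for forms: coefficients u of size below d come from a form q of degree d - 1,
  and f - q s vanishes on the points.\<close>

lemma proj_eq_zeroI:
  assumes f: "f \<in> forms r d" and u: "\<And>b. b \<in> Z \<Longrightarrow> d \<le> size b \<Longrightarrow> u b = 0"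
    and eq: "\<And>a. a \<in> Z \<Longrightarrow> val (point a) f = val (point a) s * interp u a"
  shows "proj f = \<zero>\<^bsub>B\<^esub>"
proof -
  have "\<exists>q\<in>carrier R. f - q * s \<in> points_ideal"
  proof (cases d)
    case 0
    with u have "interp u a = 0" for a by (simp add: interp_def)
    with eq have "f \<in> points_ideal"
      by (simp add: points_ideal_def form_in_vanishing_ideal_iff[OF f])
    then show ?thesis by (intro bexI[of _ 0]) auto
  next
    case (Suc d')
    \<comment> \<open>The hypothesis bounds \<open>u\<close> only on \<open>Z\<close>, whereas
      \<open>value_space\<close> asks for a bound at all exponents.\<close>
    define u' where "u' = (\<lambda>b. if b \<in> Z then u b else 0)"
    have "interp u a = interp u' a" for a
      by (auto simp: interp_def u'_def intro: sum.cong)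
    with u Suc have "interp u \<in> value_space d'"
      by (intro value_spaceI[of _ u']) (auto simp: u'_def)
    from value_space_form[OF this] obtain q where q: "q \<in> forms r d'"
      "\<And>a. a \<in> Z \<Longrightarrow> val (point a) q = interp u a"
      by blast
    have "q * s \<in> forms r d" using forms_mult[OF q(1) s_form] Suc by simp
    then have "f - q * s \<in> points_ideal"
      unfolding points_ideal_def using q(2) eq
      by (subst form_in_vanishing_ideal_iff[OF forms_diff[OF f]]) auto
    with q(1) show ?thesis by blast
  qed
  then show ?thesis using f by (subst proj_eq_zero_iff) auto
qed

lemma s_mult_interp: "a \<in> Z \<Longrightarrow> val (point a) s * interp u a = interp (linear_op k u) a"
  unfolding s_val by (rule linear_op)

section \<open>The Newton basis of each degree of the reduction\<close>

definition layer :: "nat \<Rightarrow> (nat \<Rightarrow> nat) set" where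
  "layer i = {b \<in> Z. size b = i}"

text \<open>The set \<open>S\<close> may be part of a layer, so that the dimension can be counted by
  adding one exponent at a time.\<close>

definition combination :: "(nat \<Rightarrow> nat) set \<Rightarrow> ((nat \<Rightarrow> nat) \<Rightarrow> 'k) \<Rightarrow> 'k mpoly" where
  "combination S c = (\<Sum>b\<in>S. single 0 (c b) * newton_form b)"

lemma finite_layer: "finite (layer i)"
  using finite_Z by (simp add: layer_def)

lemma combination_in_forms: "S \<subseteq> layer i \<Longrightarrow> combination S c \<in> forms r i"
  unfolding combination_def
  by (intro forms_sum const_mult_in_forms) (use newton_form_in_forms in \<open>auto simp: layer_def\<close>)

lemma val_combination:
  assumes "S \<subseteq> layer i"
  shows "val (point a) (combination S c) = interp (\<lambda>b. if b \<in> S then c b else 0) a"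
proof -
  have "val (point a) (combination S c) = (\<Sum>b\<in>S. c b * newton b a)"
    by (simp add: combination_def)
  also have "\<dots> = interp (\<lambda>b. if b \<in> S then c b else 0) a"
    unfolding interp_def using assms finite_Z
    by (intro sum.mono_neutral_cong_left) (auto simp: layer_def)
  finally show ?thesis .
qed

lemma linear_op_zero:
  assumes "b \<in> Z" "\<And>a. a \<in> Z \<Longrightarrow> u a = 0" shows "linear_op k u b = 0"
proof -
  have "shift j u b = 0" for j using assms by (simp add: shift_def down_in_Z)
  with assms show ?thesis by (simp add: linear_op_def)
qed

text \<open>A relation makes the coefficients \<open>c\<close> equal to \<open>linear_op k u\<close>
  with u in sizes below i. There the combination has no coefficients, so triangularity forces u = 0,
  and then c = 0.\<close>

lemma layer_independent:
  assumes S: "S \<subseteq> layer i" and zero: "proj (combination S c) = \<zero>\<^bsub>B\<^esub>" and b: "b \<in> S"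
  shows "c b = 0"
proof -
  let ?c = "\<lambda>b. if b \<in> S then c b else 0"
  have form: "combination S c \<in> forms r i" by (rule combination_in_forms[OF S])
  from proj_eq_zero_values[OF forms_carrier[OF form] zero, of i]
  obtain u where u: "\<And>b. i \<le> size b \<Longrightarrow> u b = 0"
    "\<And>a. a \<in> Z \<Longrightarrow> interp ?c a = val (point a) s * interp u a"
    by (auto simp: on_line_form[OF form] val_combination[OF S])
  have eq: "?c b = linear_op k u b" if "b \<in> Z" for b
  proof (rule interp_inject[OF _ that])
    fix a assume "a \<in> Z"
    with u(2)[OF this] s_mult_interp[OF this, of u] show "interp ?c a = interp (linear_op k u) a"
      by metis
  qed
  interpret T: triangular_operator "{b\<in>Z. size b < i}" size "\<lambda>b. \<Sum>j\<le>r. k j * point b j"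
    "\<lambda>c b. \<Sum>j\<in>{1..r}. k j * shift j c b"
    by (rule linear_op_triangular) (use s_nonzero in \<open>simp add: s_val\<close>)
  have "u b = 0" if "b \<in> {b\<in>Z. size b < i}" for b
  proof (rule T.injective[OF _ that, of u "\<lambda>_. 0"])
    fix b assume "b \<in> {b\<in>Z. size b < i}"
    with S have "b \<in> Z" "b \<notin> S" by (auto simp: layer_def)
    with eq[of b] have "linear_op k u b = 0" by simp
    moreover have "shift j (\<lambda>_. 0) b = (0::'k)" for j by (simp add: shift_def)
    ultimately show "(\<Sum>j\<le>r. k j * point b j) * u b + (\<Sum>j\<in>{1..r}. k j * shift j u b)
        = (\<Sum>j\<le>r. k j * point b j) * 0 + (\<Sum>j\<in>{1..r}. k j * shift j (\<lambda>_. 0) b)"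
      by (simp add: linear_op_def)
  qed
  with u(1) have "u b = 0" if "b \<in> Z" for b
    using that by (cases "size b < i") auto
  with b S eq[of b] linear_op_zero[of b u] show ?thesis by (auto simp: layer_def)
qed

text \<open>Triangularity gives a multiple of s with the same Newton coefficients as f in all sizes
  below i. Subtracting it leaves coefficients of size exactly i.\<close>

lemma layer_spans:
  assumes f: "f \<in> forms r i"
  shows "\<exists>c. proj f = proj (combination (layer i) c)"
proof -
  obtain c where c: "\<And>b. i < size b \<Longrightarrow> c b = 0" "\<And>a. a \<in> Z \<Longrightarrow> val (point a) f = interp c a"
    using form_values[OF f] by (auto simp: value_space_def)
  interpret T: triangular_operator "{b\<in>Z. size b < i}" size "\<lambda>b. \<Sum>j\<le>r. k j * point b j"
    "\<lambda>c b. \<Sum>j\<in>{1..r}. k j * shift j c b"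
    by (rule linear_op_triangular) (use s_nonzero in \<open>simp add: s_val\<close>)
  obtain u where u: "\<And>b. b \<notin> {b\<in>Z. size b < i} \<Longrightarrow> u b = 0"
    "\<And>b. b \<in> {b\<in>Z. size b < i} \<Longrightarrow> linear_op k u b = c b"
    using T.surjective[of c] finite_Z by (auto simp: linear_op_def)
  define c' where "c' b = c b - linear_op k u b" for b
  have form: "combination (layer i) c' \<in> forms r i" by (rule combination_in_forms) simp
  have "proj (f - combination (layer i) c') = \<zero>\<^bsub>B\<^esub>"
  proof (rule proj_eq_zeroI)
    fix a assume a: "a \<in> Z"
    \<comment> \<open>As u lives in sizes below i, its shifts reach at most size i.\<close>
    have high: "linear_op k u b = 0" if "b \<in> Z" "i < size b" for b
    proof -
      have "shift j u b = 0" if j: "j \<in> {1..r}" for j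
        using \<open>i < size b\<close> size_down[OF j, of b] by (auto simp: shift_def intro: u(1))
      with that show ?thesis by (simp add: linear_op_def u(1))
    qed
    have "interp (\<lambda>b. c b - (if b \<in> layer i then c' b else 0)) a = interp (linear_op k u) a"
      unfolding interp_def
    proof (rule sum.cong)
      fix b assume "b \<in> Z"
      then show "(c b - (if b \<in> layer i then c' b else 0)) * newton b a
          = linear_op k u b * newton b a"
        using u(2)[of b] c(1)[of b] high[of b] by (cases "size b" i rule: linorder_cases) (auto simp: layer_def c'_def)
    qed simp
    moreover have "interp (\<lambda>b. c b - (if b \<in> layer i then c' b else 0)) a
        = interp c a - interp (\<lambda>b. if b \<in> layer i then c' b else 0) a"
      by (simp add: interp_def sum_subtractf algebra_simps)
    ultimately show "val (point a) (f - combination (layer i) c') = val (point a) s * interp u a"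
      using a by (simp add: c(2) val_combination[of _ i] s_mult_interp)
  qed (use f form u in auto)
  then have "proj f = proj (combination (layer i) c')"
    using f form by (subst (asm) proj_diff_eq_zero_iff) auto
  then show ?thesis by blast
qed

lemma G_eq: "G i = proj ` range (combination (layer i))"
  unfolding G_def using layer_spans combination_in_forms[of "layer i" i] by (auto simp: image_iff)

lemma one_not_zero_B: "\<one>\<^bsub>B\<^esub> \<noteq> \<zero>\<^bsub>B\<^esub>"
proof
  assume "\<one>\<^bsub>B\<^esub> = \<zero>\<^bsub>B\<^esub>"
  then have "proj 1 = \<zero>\<^bsub>B\<^esub>" using proj.hom_one by simp
  from proj_eq_zero_values[OF _ this, of 0] obtain u where u: "\<forall>b. u b = 0"
    "\<forall>a\<in>Z. 1 = val (point a) s * interp u a" by auto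
  have "interp u a = 0" for a unfolding interp_def using u(1) by simp
  with u zero_in_Z show False by auto
qed

lemma subfield_G0: "subfield (G 0) B"
  unfolding G_def by (rule proj.img_is_subfield(2)[OF subfield_forms_0 one_not_zero_B])

text \<open>Each new Newton form extends the span by a line, since \<open>layer_independent\<close>
  keeps it outside the previous span.\<close>

lemma dimension_combinations:
  assumes "finite S" "S \<subseteq> layer i"
  shows "B.dimension (card S) (G 0) (proj ` range (combination S))"
  using assms
proof (induction S)
  case empty
  have "proj ` range (combination {}) = {\<zero>\<^bsub>B\<^esub>}" by (simp add: combination_def proj_zero)
  then show ?case by simp
next
  case (insert b S)
  let ?E = "proj ` range (combination S)"
  have b: "newton_form b \<in> carrier R" by (rule forms_carrier[OF newton_form_in_forms])
  have S: "combination S c \<in> carrier R" for c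
    using combination_in_forms insert.prems by blast
  have const: "single 0 x \<in> carrier R" for x by (rule forms_carrier[of _ _ 0]) auto
  have comb: "combination (insert b S) c = single 0 (c b) * newton_form b + combination S c" for c
    using insert.hyps by (simp add: combination_def)
  have notin: "proj (newton_form b) \<notin> ?E"
  proof
    assume "proj (newton_form b) \<in> ?E"
    then obtain c where c: "proj (newton_form b) = proj (combination S c)" by auto
    \<comment> \<open>Membership in the old span would be a relation with coefficient 1 at
      b.\<close>
    define c' where "c' = (\<lambda>a. if a = b then 1 else - c a)"
    have "combination S c' = - combination S c"
      unfolding combination_def sum_negf[symmetric]
      using insert.hyps by (intro sum.cong) (auto simp: c'_def single_uminus)
    then have "combination (insert b S) c' = newton_form b - combination S c"
      unfolding comb by (simp add: c'_def)
    then have "proj (combination (insert b S) c') = \<zero>\<^bsub>B\<^esub>"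
      using c proj_diff_eq_zero_iff[OF b S] by simp
    from layer_independent[OF insert.prems this, of b] show False by (simp add: c'_def)
  qed
  have K: "G 0 = proj ` range (single 0)"
  proof -
    have "forms r 0 = range (single 0 :: 'k \<Rightarrow> _)"
      by (auto elim: zero_form_const)
    then show ?thesis by (simp add: G_def)
  qed
  have "B.line_extension (G 0) (proj (newton_form b)) ?E
      = {proj (single 0 x) \<otimes>\<^bsub>B\<^esub> proj (newton_form b) \<oplus>\<^bsub>B\<^esub> proj (combination S c) | x c. True}"
    by (auto simp: B.line_extension_def K set_add_def' r_coset_def)
  also have "\<dots> = {proj (single 0 x * newton_form b + combination S c) | x c. True}"
    by (simp add: proj_add proj_mult carrier_mpoly_closed b S const)
  also have "\<dots> = proj ` range (combination (insert b S))"
  proof safe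
    fix x c
    have "combination S (c(b := x)) = combination S c"
      using insert.hyps unfolding combination_def by (intro sum.cong) auto
    then have "single 0 x * newton_form b + combination S c = combination (insert b S) (c(b := x))"
      by (simp add: comb)
    then show "proj (single 0 x * newton_form b + combination S c) \<in> proj ` range (combination (insert b S))"
      by auto
  qed (auto simp: comb)
  finally have "B.line_extension (G 0) (proj (newton_form b)) ?E = proj ` range (combination (insert b S))" .
  with B.Suc_dim[OF proj.hom_closed[OF b] notin insert.IH] insert show ?case by auto
qed

lemma h_function_B: "h_function B G i = card (layer i)"
  unfolding h_function_def
  using B.dimI[OF subfield_G0 dimension_combinations[OF finite_layer subset_refl], of i]
  by (simp add: G_eq[of i] over_def)

text \<open>All Newton coefficients have size below d here, so the quotient of f by s on the points,
  like any function on them, comes from degree d - 1.\<close>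

lemma proj_high:
  assumes f: "f \<in> forms r d" and d: "\<And>b. b \<in> Z \<Longrightarrow> size b < d"
  shows "proj f = \<zero>\<^bsub>B\<^esub>"
proof -
  obtain u where u: "\<forall>b. b \<notin> Z \<longrightarrow> u b = 0"
    "\<forall>a\<in>Z. interp u a = val (point a) f / val (point a) s"
    using interp_surj[of "\<lambda>a. val (point a) f / val (point a) s"] by blast
  show ?thesis
  proof (rule proj_eq_zeroI[OF f])
    show "u b = 0" if "b \<in> Z" "d \<le> size b" for b using d that by (auto simp: not_less[symmetric])
    show "val (point a) f = val (point a) s * interp u a" if "a \<in> Z" for a
      using u(2) s_nonzero that by simp
  qed
qed

end

section \<open>Level reductions and the example\<close>

text \<open>Purity of the lower set: by \<open>extend\<close>, an element of size other than
  \<open>e\<close> is not maximal.\<close>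

locale pure_lower_set_section = lower_set_section +
  fixes e :: nat
  assumes bounded: "b \<in> Z \<Longrightarrow> size b \<le> e"
    and extend: "b \<in> Z \<Longrightarrow> size b \<noteq> e \<Longrightarrow> \<exists>j\<in>{1..r}. up j b \<in> Z"
begin

lemma layer_socle_degree: "layer e \<noteq> {}"
proof -
  obtain b where b: "b \<in> Z" "\<And>a. a \<in> Z \<Longrightarrow> size a \<le> size b"
    using finite_Z zero_in_Z Max_in[of "size ` Z"] Max_ge[of "size ` Z"]
    by (metis (no_types, lifting) empty_iff finite_imageI imageE image_eqI)
  have "size b = e"
  proof (rule ccontr)
    assume "size b \<noteq> e"
    with extend b(1) obtain j where "j \<in> {1..r}" "up j b \<in> Z" by blast
    with b(2)[of "up j b"] show False by simp
  qed
  with b(1) show ?thesis by (auto simp: layer_def)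
qed

lemma is_socle_degree_B: "is_socle_degree B G e"
  unfolding is_socle_degree_def
proof (intro conjI allI impI)
  show "G e \<noteq> {\<zero>\<^bsub>B\<^esub>}"
  proof
    assume "G e = {\<zero>\<^bsub>B\<^esub>}"
    then have "proj (combination (layer e) (\<lambda>_. 1)) = \<zero>\<^bsub>B\<^esub>"
      using combination_in_forms[OF subset_refl, of e "\<lambda>_. 1"] by (auto simp: G_def)
    with layer_independent[OF subset_refl this] layer_socle_degree show False by auto
  qed
next
  fix i assume "e < i"
  then have "proj f = \<zero>\<^bsub>B\<^esub>" if "f \<in> forms r i" for f
    using proj_high[OF that] bounded le_less_trans by blast
  then have "G i \<subseteq> {\<zero>\<^bsub>B\<^esub>}" by (auto simp: G_def)
  moreover have "\<zero>\<^bsub>B\<^esub> \<in> G i"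
    unfolding G_def by (rule image_eqI[of _ _ 0]) (simp_all add: proj_zero)
  ultimately show "G i = {\<zero>\<^bsub>B\<^esub>}" by blast
qed

text \<open>Writing x_j f_d = s U_j on the points, with U_j of Newton degree at most d, gives f_d =
  s U_0 and U_j = x_j U_0. Purity then forces the size d coefficients of U_0 to vanish, so f_d is a
  multiple of s in the coordinate ring.\<close>

lemma component_below_zero:
  assumes f: "f \<in> carrier R" and socle: "\<And>j. j \<le> r \<Longrightarrow> proj (var j * f) = \<zero>\<^bsub>B\<^esub>"
    and d: "d < e"
  shows "proj (component d f) = \<zero>\<^bsub>B\<^esub>"
proof -
  have "\<exists>u. (\<forall>b. d < size b \<longrightarrow> u b = 0) \<and>
      (\<forall>a\<in>Z. point a j * val (point a) (component d f) = val (point a) s * interp u a)"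
    if j: "j \<le> r" for j
  proof -
    have "var j * f \<in> carrier R"
      using f forms_carrier[OF var_in_forms[OF j]] by (intro carrier_mpoly_closed)
    from proj_eq_zero_values[OF this socle[OF j], of "Suc d"] show ?thesis
      by (simp add: coeff_monom_mult val_component Suc_le_eq)
  qed
  then obtain U where U: "\<And>j b. j \<le> r \<Longrightarrow> d < size b \<Longrightarrow> U j b = 0"
    "\<And>j a. j \<le> r \<Longrightarrow> a \<in> Z \<Longrightarrow>
      point a j * val (point a) (component d f) = val (point a) s * interp (U j) a"
    by metis
  \<comment> \<open>The case j = 0, where the coordinate is 1.\<close>
  have f_eq: "val (point a) (component d f) = val (point a) s * interp (U 0) a" if "a \<in> Z" for a
    using U(2)[of 0 a] that by (simp add: point_def)
  have coord: "interp (U j) a = interp (\<lambda>b. of_nat (b j) * U 0 b + shift j (U 0) b) a"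
    if "j \<in> {1..r}" "a \<in> Z" for j a
  proof -
    have "val (point a) s * (of_nat (a j) * interp (U 0) a) = val (point a) s * interp (U j) a"
      using U(2)[of j a] f_eq[of a] that by (simp add: point_def mult_ac)
    with s_nonzero[OF that(2)] show ?thesis by (simp add: coordinate_mult_interp[OF that])
  qed
  have vanish: "U 0 b = 0" if b: "b \<in> Z" "d \<le> size b" for b
  proof (cases "size b = d")
    case True
    then obtain j where j: "j \<in> {1..r}" "up j b \<in> Z" using extend[OF b(1)] d by auto
    from interp_inject[OF coord[OF j(1)] j(2)]
    have "U j (up j b) = of_nat (Suc (b j)) * U 0 (up j b) + shift j (U 0) (up j b)" by simp
    \<comment> \<open>At \<open>up j b\<close>, of size d + 1, both \<open>U j\<close> and
      \<open>U 0\<close> vanish; only the shifted term \<open>U 0 b\<close> remains.\<close>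
    with True j(1) show ?thesis by (simp add: U(1) shift_def)
  next
    case False
    with b U(1)[of 0 b] show ?thesis by simp
  qed
  show ?thesis
    by (rule proj_eq_zeroI[OF component_in_forms[OF f], where u = "U 0"])
      (simp_all only: vanish f_eq)
qed

lemma proj_sum_zero:
  assumes "finite D" "\<And>d. d \<in> D \<Longrightarrow> F d \<in> carrier R \<and> proj (F d) = \<zero>\<^bsub>B\<^esub>"
  shows "sum F D \<in> carrier R \<and> proj (sum F D) = \<zero>\<^bsub>B\<^esub>"
  using assms by (induction D) (auto simp: proj_zero proj_add carrier_mpoly_closed)

text \<open>The variables kill a socle element, so its components below degree \<open>e\<close>
  vanish by \<open>component_below_zero\<close>; those above \<open>e\<close> vanish by
  \<open>proj_high\<close>. The element need not be homogeneous at the outset.\<close>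

lemma socle_B: "socle B G \<subseteq> G e"
proof
  fix x assume "x \<in> socle B G"
  then have x: "x \<in> carrier B" "\<And>m. m \<in> irrelevant_ideal B G \<Longrightarrow> m \<otimes>\<^bsub>B\<^esub> x = \<zero>\<^bsub>B\<^esub>"
    by (auto simp: socle_def)
  then obtain f where f: "f \<in> carrier R" "x = proj f" by (auto simp: carrier_B)
  have "proj (var j * f) = \<zero>\<^bsub>B\<^esub>" if j: "j \<le> r" for j
  proof -
    have "(\<Union>d\<in>{1..}. G d) \<subseteq> carrier B" by (auto simp: G_def carrier_B)
    from B.genideal_self[OF this] have "G 1 \<subseteq> irrelevant_ideal B G"
      by (auto simp: irrelevant_ideal_def)
    moreover have "proj (var j) \<in> G 1"
      unfolding G_def by (rule imageI) (use var_in_forms[OF j] in simp)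
    ultimately show ?thesis
      using x(2) f proj_mult[OF forms_carrier[OF var_in_forms[OF j]] f(1)] by auto
  qed
  note below = component_below_zero[OF f(1) this]
  have zero: "proj (component d f) = \<zero>\<^bsub>B\<^esub>" if "d \<noteq> e" for d
  proof (cases "d < e")
    case False
    with that bounded show ?thesis
      by (intro proj_high[OF component_in_forms[OF f(1)]]) (meson le_less_trans nat_neq_iff)
  qed (rule below)
  let ?D = "weight ` keys f"
  have "f - component e f = (\<Sum>d\<in>?D-{e}. component d f)"
  proof (cases "e \<in> ?D")
    case True
    then have "f = component e f + (\<Sum>d\<in>?D-{e}. component d f)"
      using sum.remove[of ?D e "\<lambda>d. component d f"] by (simp add: sum_components[symmetric])
    then show ?thesis by (metis add_diff_cancel_left')
  next
    case False
    then have "component e f = 0" by (auto simp: component_def intro!: sum.neutral)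
    with False show ?thesis using sum_components[of f] by simp
  qed
  moreover have "proj (\<Sum>d\<in>?D-{e}. component d f) = \<zero>\<^bsub>B\<^esub>"
    using zero forms_carrier[OF component_in_forms[OF f(1)]] by (intro conjunct2[OF proj_sum_zero]) simp_all
  ultimately have "proj f = proj (component e f)"
    using proj_diff_eq_zero_iff[OF f(1) forms_carrier[OF component_in_forms[OF f(1)]], of e] by simp
  with f show "x \<in> G e" by (auto simp: G_def)
qed

lemma level_algebra_B: "level_algebra B G"
  unfolding level_algebra_def using is_socle_degree_B socle_B by blast

end

section \<open>The lower set of the example\<close>

definition example_set :: "(nat \<Rightarrow> nat) set" where
  "example_set = {a. (\<forall>i. i \<notin> {1, 2, 3} \<longrightarrow> a i = 0) \<and> a 1 + a 2 + a 3 \<le> 12 \<and>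
     (a 1 \<le> 2 \<or> a 1 \<le> 6 \<and> a 2 \<le> 3 \<and> a 3 \<le> 3)}"

definition triple :: "nat \<Rightarrow> nat \<Rightarrow> nat \<Rightarrow> nat \<Rightarrow> nat" where
  "triple x y z = (\<lambda>_. 0)(1 := x, 2 := y, 3 := z)"

lemma triple_simps [simp]: "triple x y z 1 = x" "triple x y z (Suc 0) = x"
  "triple x y z 2 = y" "triple x y z 3 = z"
  "i \<noteq> 1 \<Longrightarrow> i \<noteq> 2 \<Longrightarrow> i \<noteq> 3 \<Longrightarrow> triple x y z i = 0"
  by (simp_all add: triple_def)

lemma eq_triple: "(\<And>i. i \<notin> {1, 2, 3} \<Longrightarrow> a i = 0) \<Longrightarrow> a = triple (a 1) (a 2) (a 3)"
  by (auto simp: triple_def fun_eq_iff)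

lemma finite_example_set: "finite example_set"
proof (rule finite_subset)
  show "example_set \<subseteq> (\<lambda>(x, y, z). triple x y z) ` ({..12} \<times> {..12} \<times> {..12})"
  proof
    fix a assume a: "a \<in> example_set"
    then have "a = triple (a 1) (a 2) (a 3)"
      by (intro eq_triple) (simp add: example_set_def)
    moreover have "(a 1, a 2, a 3) \<in> {..12} \<times> {..12} \<times> {..12}"
      using a by (auto simp: example_set_def)
    ultimately show "a \<in> (\<lambda>(x, y, z). triple x y z) ` ({..12} \<times> {..12} \<times> {..12})"
      by (intro image_eqI[of _ _ "(a 1, a 2, a 3)"]) auto
  qed
qed simp

text \<open>Only the first three coordinates vary, so one set serves every r \<ge> 3.\<close>

lemma lower_set_example:
  assumes "r \<ge> 3" shows "lower_set r example_set"
proof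
  fix a b :: "nat \<Rightarrow> nat" assume a: "a \<in> example_set" and "b \<le> a"
  then have le: "b i \<le> a i" for i by (simp add: le_fun_def)
  have "b i = 0" if "i \<notin> {1, 2, 3}" for i
    using a le[of i] that by (simp add: example_set_def)
  moreover have "b 1 + b 2 + b 3 \<le> 12 \<and> (b 1 \<le> 2 \<or> b 1 \<le> 6 \<and> b 2 \<le> 3 \<and> b 3 \<le> 3)"
    using a le[of 1] le[of 2] le[of 3] unfolding example_set_def by force
  ultimately show "b \<in> example_set" by (simp add: example_set_def)
next
  show "a i = 0" if "a \<in> example_set" "i \<notin> {1..r}" for a i
    using that assms by (auto simp: example_set_def)
qed (simp_all add: finite_example_set, simp add: example_set_def)

lemma size_example:
  assumes "r \<ge> 3" "a \<in> example_set"
  shows "lower_set.size r a = a 1 + a 2 + a 3"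
proof -
  have "lower_set.size r a = (\<Sum>j\<in>{1..r}. a j)"
    by (rule lower_set.size_def[OF lower_set_example[OF assms(1)]])
  also have "\<dots> = (\<Sum>j\<in>{1,2,3}. a j)"
    using assms by (intro sum.mono_neutral_right) (auto simp: example_set_def)
  finally show ?thesis by simp
qed

text \<open>In the planes with \<open>a 1 \<le> 2\<close> the second coordinate can grow until the
  size is 12. On the shifted grid one moves towards its corner (6, 3, 3), which also has size
  12.\<close>

lemma extend_example:
  assumes "r \<ge> 3" "a \<in> example_set" "a 1 + a 2 + a 3 \<noteq> 12"
  shows "\<exists>j\<in>{1..r}. up j a \<in> example_set"
proof -
  consider "a 1 \<le> 2" | "2 < a 1" "a 1 < 6" | "a 1 = 6" "a 2 < 3" | "a 1 = 6" "a 2 = 3" "a 3 < 3"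
    using assms(2,3) by (fastforce simp: example_set_def)
  then show ?thesis
  proof cases
    case 1
    with assms show ?thesis by (intro bexI[of _ 2]) (auto simp: example_set_def up_def)
  next
    case 2
    with assms show ?thesis by (intro bexI[of _ 1]) (auto simp: example_set_def up_def)
  next
    case 3
    with assms show ?thesis by (intro bexI[of _ 2]) (auto simp: example_set_def up_def)
  next
    case 4
    with assms show ?thesis by (intro bexI[of _ 3]) (auto simp: example_set_def up_def)
  qed
qed

lemma card_layer_example:
  assumes i: "9 \<le> i" "i \<le> 12"
  shows "card {a \<in> example_set. a 1 + a 2 + a 3 = i}
    = (\<Sum>x\<le>6. if x \<le> 2 then Suc (i - x) else 4 - (i - x - 3))"
proof -
  \<comment> \<open>Slices by the first coordinate x, with \<open>a 3\<close> determined by the sum.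
    For x \<ge> 3 the condition \<open>a 3 \<le> 3\<close> becomes
    \<open>a 2 \<ge> i - x - 3\<close>. Since i \<ge> 9 no subtraction here truncates; in the count
    \<open>4 - (i - x - 3)\<close> truncation yields 0 for empty slices.\<close>
  define W where "W x = (if x \<le> 2 then {..i - x} else {i - x - 3..3})" for x
  let ?g = "\<lambda>(x, y). triple x y (i - x - y)"
  have "{a \<in> example_set. a 1 + a 2 + a 3 = i} = ?g ` (SIGMA x:{..6}. W x)"
  proof (intro equalityI subsetI)
    fix a assume a: "a \<in> {a \<in> example_set. a 1 + a 2 + a 3 = i}"
    then have "a = triple (a 1) (a 2) (a 3)"
      by (intro eq_triple) (simp add: example_set_def)
    moreover have "a 3 = i - a 1 - a 2" using a by auto
    moreover have "(a 1, a 2) \<in> (SIGMA x:{..6}. W x)"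
      using a by (auto simp: example_set_def W_def)
    ultimately show "a \<in> ?g ` (SIGMA x:{..6}. W x)"
      by (intro image_eqI[of _ _ "(a 1, a 2)"]) auto
  next
    fix a assume "a \<in> ?g ` (SIGMA x:{..6}. W x)"
    then obtain x y where xy: "a = triple x y (i - x - y)" "x \<le> 6" "y \<in> W x" by auto
    with i show "a \<in> {a \<in> example_set. a 1 + a 2 + a 3 = i}"
      by (auto simp: example_set_def W_def split: if_splits)
  qed
  moreover have "inj_on ?g (SIGMA x:{..6}. W x)"
    by (rule inj_onI) (auto dest: fun_cong[of _ _ 1] fun_cong[of _ _ 2] simp del: One_nat_def)
  ultimately have "card {a \<in> example_set. a 1 + a 2 + a 3 = i} = card (SIGMA x:{..6}. W x)"
    by (simp add: card_image)
  also have "\<dots> = (\<Sum>x\<le>6. card (W x))"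
    by (subst card_SigmaI) (auto simp: W_def)
  also have "\<dots> = (\<Sum>x\<le>6. if x \<le> 2 then Suc (i - x) else 4 - (i - x - 3))"
    by (rule sum.cong) (auto simp: W_def)
  finally show ?thesis .
qed

text \<open>A peak at or before i excludes the later rise from j to k; a peak after i excludes the
  descent from i to i + 1.\<close>

lemma not_unimodalI:
  assumes "i < j" "j < k" "k < length h" "h ! i > h ! (i + 1)" "h ! j < h ! k"
  shows "\<not> unimodal h"
proof
  assume "unimodal h"
  then obtain m where m: "m < length h" "sorted_wrt (\<le>) (take (Suc m) h)" "sorted_wrt (\<ge>) (drop m h)"
    by (auto simp: unimodal_def)
  show False
  proof (cases "m \<le> i")
    case True
    then have "j - m < k - m" "k - m < length (drop m h)"
      using assms by simp_all
    from sorted_wrt_nth_less[OF m(3) this] have "h ! k \<le> h ! j"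
      using True assms by simp
    with assms show False by simp
  next
    case False
    then have "h ! i \<le> h ! (i + 1)"
      using sorted_wrt_nth_less[OF m(2), of i "i + 1"] m(1) by auto
    with assms show False by simp
  qed
qed

theorem corollary5p4:
  fixes r :: nat
  assumes "r \<ge> 3"
  shows "\<exists>I :: 'k::field_char_0 mpoly set.
    reduced_point_set r I \<and> level_point_set r I \<and>
    (\<forall>l \<in> regular_linear_forms r I.
       nonunimodal_algebra (artinian_reduction r I l) (artinian_reduction_grading r I l))"
proof -
  interpret lower_set r example_set by (rule lower_set_example[OF assms])
  let ?I = "points_ideal :: 'k mpoly set"
  have "reduced_point_set r ?I"
    unfolding points_ideal_def using finite_Z zero_in_Z
    by (intro reduced_point_set_vanishing_ideal) (auto simp: point_def)
  moreover have "level_algebra (artinian_reduction r ?I l) (artinian_reduction_grading r ?I l) \<and>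
      nonunimodal_algebra (artinian_reduction r ?I l) (artinian_reduction_grading r ?I l)"
    if l: "l \<in> regular_linear_forms r ?I" for l
  proof -
    obtain s where s: "s \<in> forms r 1" "l = ?I +>\<^bsub>mpoly_ring r\<^esub> s"
      "\<And>a. a \<in> example_set \<Longrightarrow> val (point a) s \<noteq> 0"
      using regular_linear_form_nonvanishing[OF l] by blast
    obtain k where k: "\<And>p. val p s = (\<Sum>j\<le>r. k j * p j)"
      using linear_form_val[OF s(1)] by blast
    interpret pure_lower_set_section r example_set s k 12
    proof
      show "size a \<le> 12" if "a \<in> example_set" for a
        using that size_example[OF assms that] by (simp add: example_set_def)
      show "\<exists>j\<in>{1..r}. up j a \<in> example_set" if "a \<in> example_set" "size a \<noteq> 12" for a
        using extend_example[OF assms that(1)] that(2) size_example[OF assms that(1)] by simp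
    qed (use s k in auto)
    \<comment> \<open>Identifies the reduction by an arbitrary regular \<open>l\<close> with the one
      analysed for its representative \<open>s\<close>.\<close>
    have B: "artinian_reduction r ?I l = B"
      by (simp add: artinian_reduction_def B_def coord_ring_def s(2))
    have G: "artinian_reduction_grading r ?I l = G"
      by (rule ext) (simp add: artinian_reduction_grading_def coord_grading_def quot_grading_def
          coord_ring_def G_def proj_def double_coset_def s(2) image_image)
    have h: "h_function B G i = (\<Sum>x\<le>6. if x \<le> 2 then Suc (i - x) else 4 - (i - x - 3))"
      if "9 \<le> i" "i \<le> 12" for i
    proof -
      have "layer i = {a \<in> example_set. a 1 + a 2 + a 3 = i}"
        unfolding layer_def using size_example[OF assms] by auto
      then show ?thesis by (simp only: h_function_B card_layer_example[OF that])
    qed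
    have sum_six: "(\<Sum>x\<le>6. F x) = F 0 + F 1 + F 2 + F 3 + F 4 + F 5 + F 6" for F :: "nat \<Rightarrow> nat"
      by (simp add: eval_nat_numeral)
    have "h_function B G 9 = 37" "h_function B G 10 = 36" "h_function B G 11 = 36"
      "h_function B G 12 = 37"
      using h[of 9] h[of 10] h[of 11] h[of 12] by (simp_all add: sum_six)
    then have "\<not> unimodal (map (h_function B G) [0..<Suc 12])"
      \<comment> \<open>The descent is 37 > 36 in degrees 9 and 10, the later rise 36 < 37 in
        degrees 11 and 12.\<close>
      by (intro not_unimodalI[of 9 11 12]) (simp_all del: upt_Suc)
    then show ?thesis
      unfolding B G nonunimodal_algebra_def using level_algebra_B is_socle_degree_B by blast
  qed
  ultimately show ?thesis unfolding level_point_set_def by blast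
qed

end
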